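(* Let $X$ be a spectrally positive Lévy process with non-monotone paths and finite mean $\mu=\mathbb{E}[X_1]$, and let $q>0$. For $\beta>0$ let $v^\beta$ denote the value function of the dividend payment problem with fixed transaction cost $\beta$, and let $\hat v$ denote the value function of the dividend payment problem without transaction costs. Then $v^\beta$ converges to $\hat v$ uniformly on $[0,\infty)$ as $\beta\downarrow0$.
   Context: Process. $X=\{X_t;t\ge0\}$ is a spectrally positive Lévy process; $\mathbb{P}_x$ is the law under which $X_0=x$, $\mathbb{P}=\mathbb{P}_0$, and $\mathbb{F}=\{\mathcal{F}_t\}$ is the filtration generated by $X$. Its Laplace exponent is $\psi(s)=\log\mathbb{E}[e^{-sX_1}]=cs+\frac12\sigma^2s^2+\int_{(0,\infty)}(e^{-sz}-1+sz1_{\{0<z<1\}})\nu(dz)$, where $\nu$ is a Lévy measure on $(0,\infty)$ with $\int(1\wedge z^2)\nu(dz)<\infty$. The case where $X$ has monotone paths a.s. is excluded. $\mu:=\mathbb{E}[X_1]=-\psi'(0+)$ is assumed finite. Fix the discount rate $q>0$. Problem with transaction cost $\beta>0$. A strategy $\pi=\{L^\pi_t;t\ge0\}$ is a nondecreasing, right-continuous, $\mathbb{F}$-adapted pure jump process, $L_{0-}^\pi=0$, $L_t^\pi=\sum_{0\le s\le t}\Delta L_s^\pi$. The controlled surplus is $U_t^\pi=X_t-L_t^\pi$ with $U_{0-}^\pi=x$; ruin time $\sigma^\pi=\inf\{t>0:U_t^\pi<0\}$. $\Pi$ is the set of strategies with $\Delta L_t^\pi\le U_{t-}^\pi+\Delta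 X_t$ for $t\le\sigma^\pi$ a.s. Then $v^\beta(x)=\sup_{\pi\in\Pi}\mathbb{E}_x\big[\int_0^{\sigma^\pi}e^{-qt}d\big(L_t^\pi-\sum_{0\le s\le t}\beta1_{\{\Delta L_s^\pi>0\}}\big)\big]$, $x\ge0$ (a payment at time $0$ is included). Problem without transaction costs. $\hat v(x)=\sup_\pi\mathbb{E}_x\big[\int_0^{\sigma^\pi}e^{-qt}dL_t^\pi\big]$, $x\ge0$, where the supremum is over all nondecreasing, right-continuous, $\mathbb{F}$-adapted processes $L^\pi$ with $L^\pi_{0-}=0$ (not necessarily pure jump) satisfying the same constraint $\Delta L_t^\pi\le U_{t-}^\pi+\Delta X_t$ for $t\le\sigma^\pi$, with the same $U^\pi,\sigma^\pi$. It is known from earlier work that $\hat v(x)=-R^{(q)}(a^*-x)$ with $a^*=(\overline Z^{(q)})^{-1}(\mu/q)$ if $\mu>0$, and $\hat v(x)=x$ if $\mu\le0$, where $\Phi(q)=\sup\{\lambda\ge0:\psi(\lambda)=q\}$; $W^{(q)}$ is zero on $(-\infty,0)$, continuous and strictly increasing on $[0,\infty)$, with $\int_0^\infty e^{-sx}W^{(q)}(x)dx=1/(\psi(s)-q)$ for $s>\Phi(q)$; $Z^{(q)}(x)=1+q\int_0^xW^{(q)}(y)dy$; $\overline Z^{(q)}(x)=\int_0^xZ^{(q)}(z)dz$; $R^{(q)}(x)=\overline Z^{(q)}(x)-\mu/q$. *)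

theory Defs
  imports "HOL-Probability.Probability"
begin

text \<open>
  Paths are functions of a time \<open>t :: real\<close> of which only the values at \<open>t \<ge> 0\<close> matter.
  \<open>left_value z f t\<close> is \<open>f (t-)\<close>, with the convention \<open>f (0-) = z\<close>.
\<close>

definition left_value :: "real \<Rightarrow> (real \<Rightarrow> real) \<Rightarrow> real \<Rightarrow> real" where
  "left_value z f t = (if t \<le> 0 then z else Lim (at_left t) f)"

definition jump :: "real \<Rightarrow> (real \<Rightarrow> real) \<Rightarrow> real \<Rightarrow> real" where
  "jump z f t = f t - left_value z f t"


locale levy_process = prob_space M for M :: "'a measure" +
  fixes X :: "real \<Rightarrow> 'a \<Rightarrow> real"
  assumes levy_measurable: "\<And>t. 0 \<le> t \<Longrightarrow> X t \<in> borel_measurable M"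
    and levy_start: "AE \<omega> in M. X 0 \<omega> = 0"
    and levy_indep_increments:
      "\<And>(t :: nat \<Rightarrow> real) n. 0 \<le> t 0 \<Longrightarrow> incseq t \<Longrightarrow>
         indep_vars (\<lambda>_. borel) (\<lambda>i \<omega>. X (t (Suc i)) \<omega> - X (t i) \<omega>) {..<n}"
    and levy_stationary_increments:
      "\<And>s t. 0 \<le> s \<Longrightarrow> s \<le> t \<Longrightarrow>
         distr M borel (\<lambda>\<omega>. X t \<omega> - X s \<omega>) = distr M borel (X (t - s))"
    and levy_right_continuous:
      "AE \<omega> in M. \<forall>t\<ge>0. continuous (at_right t) (\<lambda>s. X s \<omega>)"
    and levy_left_limits:
      "AE \<omega> in M. \<forall>t>0. \<exists>l. ((\<lambda>s. X s \<omega>) \<longlongrightarrow> l) (at_left t)"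

locale spectrally_positive_levy_process = levy_process +
  assumes no_negative_jumps: "AE \<omega> in M. \<forall>t>0. 0 \<le> jump 0 (\<lambda>s. X s \<omega>) t"

definition natural_filtration :: "'a measure \<Rightarrow> (real \<Rightarrow> 'a \<Rightarrow> real) \<Rightarrow> real \<Rightarrow> 'a measure" where
  "natural_filtration M X t =
     sigma (space M) (\<Union>s\<in>{0..t}. {X s -` A \<inter> space M | A. A \<in> sets borel})"

text \<open>
  In what follows \<open>X\<close> starts at 0, and the law of the process started at \<open>x\<close> is realised
  by \<open>x + X\<close> under \<open>M\<close>; both processes generate the same filtration.
\<close>

definition surplus ::
    "(real \<Rightarrow> 'a \<Rightarrow> real) \<Rightarrow> real \<Rightarrow> (real \<Rightarrow> 'a \<Rightarrow> real) \<Rightarrow> 'a \<Rightarrow> real \<Rightarrow> real" where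
  "surplus X x L \<omega> t = x + X t \<omega> - L t \<omega>"

definition ruin_time ::
    "(real \<Rightarrow> 'a \<Rightarrow> real) \<Rightarrow> real \<Rightarrow> (real \<Rightarrow> 'a \<Rightarrow> real) \<Rightarrow> 'a \<Rightarrow> ereal" where
  "ruin_time X x L \<omega> = (INF t\<in>{t. 0 < t \<and> surplus X x L \<omega> t < 0}. ereal t)"

text \<open>The condition \<open>0 \<le> L 0 \<omega>\<close> is monotonicity at time 0, given that \<open>L (0-) = 0\<close>.\<close>

definition dividend_process ::
    "'a measure \<Rightarrow> (real \<Rightarrow> 'a \<Rightarrow> real) \<Rightarrow> (real \<Rightarrow> 'a \<Rightarrow> real) \<Rightarrow> bool" where
  "dividend_process M X L \<longleftrightarrow>
     (\<forall>t\<ge>0. L t \<in> borel_measurable (natural_filtration M X t)) \<and>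
     (\<forall>\<omega>\<in>space M. 0 \<le> L 0 \<omega> \<and> mono_on {0..} (\<lambda>t. L t \<omega>) \<and>
        (\<forall>t\<ge>0. continuous (at_right t) (\<lambda>s. L s \<omega>)))"

definition admissible_strategies ::
    "'a measure \<Rightarrow> (real \<Rightarrow> 'a \<Rightarrow> real) \<Rightarrow> real \<Rightarrow> (real \<Rightarrow> 'a \<Rightarrow> real) set" where
  "admissible_strategies M X x =
     {L. dividend_process M X L \<and>
         (AE \<omega> in M. \<forall>t\<ge>0. ereal t \<le> ruin_time X x L \<omega> \<longrightarrow>
            jump 0 (\<lambda>s. L s \<omega>) t
              \<le> left_value x (surplus X x L \<omega>) t + jump 0 (\<lambda>s. X s \<omega>) t)}"

definition pure_jump :: "'a measure \<Rightarrow> (real \<Rightarrow> 'a \<Rightarrow> real) \<Rightarrow> bool" where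
  "pure_jump M L \<longleftrightarrow>
     (\<forall>\<omega>\<in>space M. \<forall>t\<ge>0. (jump 0 (\<lambda>s. L s \<omega>) has_sum L t \<omega>) {0..t})"

definition lifetime ::
    "(real \<Rightarrow> 'a \<Rightarrow> real) \<Rightarrow> real \<Rightarrow> (real \<Rightarrow> 'a \<Rightarrow> real) \<Rightarrow> 'a \<Rightarrow> real set" where
  "lifetime X x L \<omega> = {t. 0 \<le> t \<and> ereal t \<le> ruin_time X x L \<omega>}"

text \<open>
  The Stieltjes integral of \<open>exp (- q * t)\<close> against \<open>dL\<close> over the closed interval from 0 to the
  ruin time. Extending \<open>L\<close> by 0 to negative times gives the measure an atom of mass
  \<open>L 0 \<omega>\<close> at 0, which is the payment at time 0.
\<close>

definition discounted_dividends ::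
    "(real \<Rightarrow> 'a \<Rightarrow> real) \<Rightarrow> real \<Rightarrow> real \<Rightarrow> (real \<Rightarrow> 'a \<Rightarrow> real) \<Rightarrow> 'a \<Rightarrow> ennreal" where
  "discounted_dividends X q x L \<omega> =
     (\<integral>\<^sup>+ t. ennreal (exp (- q * t)) * indicator (lifetime X x L \<omega>) t
        \<partial>interval_measure (\<lambda>t. if t < 0 then 0 else L t \<omega>))"

text \<open>
  The integral of \<open>exp (- q * t)\<close> against the process that increases by \<open>\<beta>\<close> at each jump of \<open>L\<close>,
  i.e. the sum of \<open>\<beta> * exp (- q * t)\<close> over the jump times \<open>t\<close> up to ruin; it may be infinite.
\<close>

definition discounted_costs ::
    "(real \<Rightarrow> 'a \<Rightarrow> real) \<Rightarrow> real \<Rightarrow> real \<Rightarrow> real \<Rightarrow> (real \<Rightarrow> 'a \<Rightarrow> real) \<Rightarrow> 'a \<Rightarrow> ennreal" where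
  "discounted_costs X q \<beta> x L \<omega> =
     (\<integral>\<^sup>+ t. ennreal (\<beta> * exp (- q * t))
        \<partial>count_space {t \<in> lifetime X x L \<omega>. 0 < jump 0 (\<lambda>s. L s \<omega>) t})"

text \<open>
  Expectation of an extended real random variable, as positive part minus negative part
  (\<open>e2ennreal\<close> truncates negative numbers to 0).
\<close>

definition ereal_expectation :: "'a measure \<Rightarrow> ('a \<Rightarrow> ereal) \<Rightarrow> ereal" where
  "ereal_expectation M f =
     enn2ereal (\<integral>\<^sup>+ \<omega>. e2ennreal (f \<omega>) \<partial>M) - enn2ereal (\<integral>\<^sup>+ \<omega>. e2ennreal (- f \<omega>) \<partial>M)"

definition value_with_costs ::
    "'a measure \<Rightarrow> (real \<Rightarrow> 'a \<Rightarrow> real) \<Rightarrow> real \<Rightarrow> real \<Rightarrow> real \<Rightarrow> ereal" where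
  "value_with_costs M X q \<beta> x =
     (SUP L \<in> {L \<in> admissible_strategies M X x. pure_jump M L}.
        ereal_expectation M (\<lambda>\<omega>. enn2ereal (discounted_dividends X q x L \<omega>)
                                  - enn2ereal (discounted_costs X q \<beta> x L \<omega>)))"

definition value_without_costs ::
    "'a measure \<Rightarrow> (real \<Rightarrow> 'a \<Rightarrow> real) \<Rightarrow> real \<Rightarrow> real \<Rightarrow> ereal" where
  "value_without_costs M X q x =
     (SUP L \<in> admissible_strategies M X x.
        ereal_expectation M (\<lambda>\<omega>. enn2ereal (discounted_dividends X q x L \<omega>)))"

end

theory Submission
  imports Defs
begin

text \<open>
  No explicit formula for the value functions is needed: an arbitrary strategy \<open>L\<close> of the problem
  without costs, started from \<open>x\<close>, is turned pathwise into one that pays only on the grid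
  \<open>0, d, 2 d, \<dots>\<close>. At a grid time it raises the total payments to the target \<open>max (L t) (x - a)\<close>,
  or as far towards it as the surplus allows; this is automatically admissible. Its number of
  payments is bounded, so its discounted costs are at most \<open>\<beta> / (1 - exp (- q d))\<close>.

  The value lost is bounded independently of \<open>L\<close> and \<open>x\<close> because the mass beyond \<open>a\<close> is paid at
  once, so that only an amount of order \<open>a + sup \<bar>X\<bar>\<close> is delayed by at most \<open>d\<close>. Otherwise, at a
  given time the new strategy is behind \<open>L\<close> only by a decrease of \<open>X\<close> over a time less than \<open>d\<close>,
  which tends to 0 with \<open>d\<close> since \<open>X\<close> has no negative jumps, or on the event that \<open>X\<close> has gone
  below \<open>- a\<close>. The expected error vanishes by dominated convergence as \<open>a\<close> grows and \<open>d\<close> shrinks;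
  the dominating variable is the running supremum of \<open>\<bar>X\<bar>\<close>, whose mean grows at most linearly by
  Ottaviani's inequality.
\<close>

subsection \<open>Maximal inequality\<close>

text \<open>Ruin is the obstacle: the two strategies are ruined at different times, and either may
  come first. Writing \<open>exp (- q * t)\<close> as the integral of
  \<open>q * exp (- q * s)\<close> over \<open>s \<ge> t\<close> reduces the value to the totals
  paid up to the earlier of \<open>s\<close> and ruin, so it suffices to compare the total of
  \<open>L\<close> stopped at \<open>s\<close> with that of the new strategy stopped at
  \<open>s + d\<close>. The delay costs a factor \<open>exp (q * d)\<close> on the mass not paid at
  once, an error of order \<open>d * a\<close> for large \<open>a\<close>, while the event that
  \<open>X\<close> falls below \<open>- a\<close> asks for large \<open>a\<close>; hence
  \<open>d\<close> has to shrink faster than \<open>1 / a\<close>. Measurability in \<omega> of the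
  discounted dividends is never established. The loss is therefore bounded by a measurable
  functional of the path of \<open>X\<close> alone, and expectations of dividends are handled as
  lower integrals.\<close>

lemma (in prob_space) ottaviani_inequality:
  fixes Y :: "nat \<Rightarrow> 'a \<Rightarrow> real"
  assumes indep: "indep_vars (\<lambda>_. borel) Y {..<n}"
    and half: "\<And>k. k \<le> n \<Longrightarrow> prob {\<omega>\<in>space M. c < \<bar>\<Sum>i=k..<n. Y i \<omega>\<bar>} \<le> 1/2"
  shows "prob {\<omega>\<in>space M. \<exists>k\<le>n. 2 * c < \<bar>\<Sum>i<k. Y i \<omega>\<bar>}
    \<le> 2 * prob {\<omega>\<in>space M. c < \<bar>\<Sum>i<n. Y i \<omega>\<bar>}"
proof -
  have Y[measurable]: "Y i \<in> borel_measurable M" if "i < n" for i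
    using indep that by (auto simp: indep_vars_def)
  have S[measurable]: "(\<lambda>\<omega>. \<Sum>i<k. Y i \<omega>) \<in> borel_measurable M" if "k \<le> n" for k
    using that by (intro borel_measurable_sum) auto
  have R[measurable]: "(\<lambda>\<omega>. \<Sum>i=k..<n. Y i \<omega>) \<in> borel_measurable M" for k
    by (intro borel_measurable_sum) auto
  \<comment> \<open>On \<open>A k\<close> the partial sums exceed \<open>2 * c\<close> in modulus
    for the first time at index \<open>k\<close>; on \<open>B k\<close> the remaining terms move the
    sum by at most \<open>c\<close>. The first event depends on the terms before \<open>k\<close>,
    the second on those from \<open>k\<close> on, so they are independent, and on their intersection
    the full sum still exceeds \<open>c\<close> in modulus.\<close>
  define A where "A k = {\<omega>\<in>space M. 2 * c < \<bar>\<Sum>i<k. Y i \<omega>\<bar> \<and> (\<forall>j<k. \<bar>\<Sum>i<j. Y i \<omega>\<bar> \<le> 2 * c)}" for k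
  define B where "B k = {\<omega>\<in>space M. \<bar>\<Sum>i=k..<n. Y i \<omega>\<bar> \<le> c}" for k
  have Am[measurable]: "A k \<in> sets M" if "k \<le> n" for k
  proof -
    \<comment> \<open>An intersection over no index would be \<open>UNIV\<close> rather than
      \<open>space M\<close>, so index 0 is treated apart.\<close>
    have "A k = {\<omega>\<in>space M. 2 * c < \<bar>\<Sum>i<k. Y i \<omega>\<bar>} \<inter> (\<Inter>j\<in>{..<k}. {\<omega>\<in>space M. \<bar>\<Sum>i<j. Y i \<omega>\<bar> \<le> 2 * c})"
      if "k \<noteq> 0" using that unfolding A_def by auto
    moreover have "A 0 = {\<omega>\<in>space M. 2 * c < \<bar>0\<bar>}" unfolding A_def by auto
    ultimately show ?thesis using that S by (cases "k = 0") (auto intro!: sets.Int sets.finite_INT)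
  qed
  have Bm[measurable]: "B k \<in> sets M" for k unfolding B_def by measurable
  have AB: "prob (A k) \<le> 2 * prob (A k \<inter> B k)" if k: "k \<le> n" for k
  proof -
    let ?P1 = "PiM {..<k} (\<lambda>_. borel :: real measure)" and ?P2 = "PiM {k..<n} (\<lambda>_. borel :: real measure)"
    have iv: "indep_var ?P1 (\<lambda>\<omega>. \<lambda>i\<in>{..<k}. Y i \<omega>) ?P2 (\<lambda>\<omega>. \<lambda>i\<in>{k..<n}. Y i \<omega>)"
      using k by (intro indep_var_restrict[OF indep]) auto
    define C where "C = {y\<in>space ?P1. 2 * c < \<bar>\<Sum>i<k. y i\<bar> \<and> (\<forall>j\<in>{..<k}. \<bar>\<Sum>i<j. y i\<bar> \<le> 2 * c)}"
    define D where "D = {y\<in>space ?P2. \<bar>\<Sum>i=k..<n. y i\<bar> \<le> c}"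
    have m1: "(\<lambda>y. \<Sum>i<j. y i) \<in> borel_measurable ?P1" if "j \<le> k" for j
      using that by (intro borel_measurable_sum measurable_component_singleton) auto
    have C: "C \<in> sets ?P1"
    proof -
      have "{y\<in>space ?P1. \<forall>j\<in>{..<k}. \<bar>\<Sum>i<j. y i\<bar> \<le> 2 * c} \<in> sets ?P1"
        using m1 by (intro sets.sets_Collect_finite_All borel_measurable_le) (auto intro!: borel_measurable_abs)
      then show ?thesis unfolding C_def using m1[of k]
        by (intro sets.sets_Collect_conj borel_measurable_less) (auto intro!: borel_measurable_abs)
    qed
    have D: "D \<in> sets ?P2"
      unfolding D_def
      by (intro borel_measurable_le borel_measurable_abs borel_measurable_sum measurable_component_singleton) auto
    have "prob ((\<lambda>\<omega>. (\<lambda>i\<in>{..<k}. Y i \<omega>, \<lambda>i\<in>{k..<n}. Y i \<omega>)) -` (C \<times> D) \<inter> space M)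
        = prob ((\<lambda>\<omega>. \<lambda>i\<in>{..<k}. Y i \<omega>) -` C \<inter> space M) * prob ((\<lambda>\<omega>. \<lambda>i\<in>{k..<n}. Y i \<omega>) -` D \<inter> space M)"
      by (rule indep_varD[OF iv C D])
    moreover have "(\<lambda>\<omega>. \<lambda>i\<in>{..<k}. Y i \<omega>) -` C \<inter> space M = A k"
      unfolding A_def C_def by (auto simp: space_PiM)
    moreover have "(\<lambda>\<omega>. \<lambda>i\<in>{k..<n}. Y i \<omega>) -` D \<inter> space M = B k"
      unfolding B_def D_def by (auto simp: space_PiM)
    moreover have "(\<lambda>\<omega>. (\<lambda>i\<in>{..<k}. Y i \<omega>, \<lambda>i\<in>{k..<n}. Y i \<omega>)) -` (C \<times> D) \<inter> space M
        = ((\<lambda>\<omega>. \<lambda>i\<in>{..<k}. Y i \<omega>) -` C \<inter> space M) \<inter> ((\<lambda>\<omega>. \<lambda>i\<in>{k..<n}. Y i \<omega>) -` D \<inter> space M)"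
      by auto
    ultimately have eq: "prob (A k \<inter> B k) = prob (A k) * prob (B k)" by simp
    have "B k = space M - {\<omega>\<in>space M. c < \<bar>\<Sum>i=k..<n. Y i \<omega>\<bar>}" unfolding B_def by auto
    then have "prob (B k) = 1 - prob {\<omega>\<in>space M. c < \<bar>\<Sum>i=k..<n. Y i \<omega>\<bar>}"
      by (simp add: prob_compl)
    with half[OF k] have "1/2 \<le> prob (B k)" by simp
    then have "prob (A k) * (1/2) \<le> prob (A k) * prob (B k)" by (intro mult_left_mono) auto
    with eq show ?thesis by simp
  qed
  have disj: "disjoint_family_on A {..n}"
  proof -
    have "A i \<inter> A j = {}" if "i < j" for i j using that unfolding A_def by force
    then show ?thesis unfolding disjoint_family_on_def
      by (metis inf_commute linorder_neqE_nat)
  qed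
  have "{\<omega>\<in>space M. \<exists>k\<le>n. 2 * c < \<bar>\<Sum>i<k. Y i \<omega>\<bar>} \<subseteq> (\<Union>k\<in>{..n}. A k)"
  proof
    fix \<omega> assume w: "\<omega> \<in> {\<omega>\<in>space M. \<exists>k\<le>n. 2 * c < \<bar>\<Sum>i<k. Y i \<omega>\<bar>}"
    then obtain k where k: "k \<le> n" "2 * c < \<bar>\<Sum>i<k. Y i \<omega>\<bar>" by auto
    define m where "m = (LEAST k. 2 * c < \<bar>\<Sum>i<k. Y i \<omega>\<bar>)"
    have "2 * c < \<bar>\<Sum>i<m. Y i \<omega>\<bar>" unfolding m_def by (rule LeastI[of _ k]) (rule k)
    moreover have "m \<le> k" unfolding m_def by (rule Least_le) (rule k)
    moreover have "\<bar>\<Sum>i<j. Y i \<omega>\<bar> \<le> 2 * c" if "j < m" for j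
      using not_less_Least[of j "\<lambda>k. 2 * c < \<bar>\<Sum>i<k. Y i \<omega>\<bar>"] that unfolding m_def by simp
    ultimately have "\<omega> \<in> A m" "m \<le> n" using k w unfolding A_def by auto
    then show "\<omega> \<in> (\<Union>k\<in>{..n}. A k)" by auto
  qed
  then have "prob {\<omega>\<in>space M. \<exists>k\<le>n. 2 * c < \<bar>\<Sum>i<k. Y i \<omega>\<bar>} \<le> prob (\<Union>k\<in>{..n}. A k)"
    by (rule finite_measure_mono) (auto intro!: sets.finite_UN)
  also have "\<dots> = (\<Sum>k\<le>n. prob (A k))"
    using disj by (intro finite_measure_finite_Union) auto
  also have "\<dots> \<le> (\<Sum>k\<le>n. 2 * prob (A k \<inter> B k))" by (intro sum_mono AB) auto
  also have "\<dots> = 2 * prob (\<Union>k\<in>{..n}. A k \<inter> B k)"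
  proof -
    have "prob (\<Union>k\<in>{..n}. A k \<inter> B k) = (\<Sum>k\<le>n. prob (A k \<inter> B k))"
      using disj by (intro finite_measure_finite_Union) (auto simp: disjoint_family_on_def)
    then show ?thesis by (simp add: sum_distrib_left)
  qed
  also have "\<dots> \<le> 2 * prob {\<omega>\<in>space M. c < \<bar>\<Sum>i<n. Y i \<omega>\<bar>}"
  proof -
    have "(\<Union>k\<in>{..n}. A k \<inter> B k) \<subseteq> {\<omega>\<in>space M. c < \<bar>\<Sum>i<n. Y i \<omega>\<bar>}"
    proof (safe, goal_cases)
      case (1 \<omega> k) then show ?case by (simp add: A_def)
    next
      case (2 \<omega> k)
      have "(\<Sum>i<n. Y i \<omega>) = (\<Sum>i<k. Y i \<omega>) + (\<Sum>i=k..<n. Y i \<omega>)"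
        using 2(1) by (metis atLeast0LessThan le0 sum.atLeastLessThan_concat)
      then show ?case using 2(2,3) unfolding A_def B_def by auto
    qed
    then show ?thesis using S[of n] by (intro mult_left_mono finite_measure_mono) auto
  qed
  finally show ?thesis .
qed

section \<open>Expectations from tail probabilities\<close>

lemma nn_integral_layer_cake:
  assumes "sigma_finite_measure M" and f[measurable]: "f \<in> borel_measurable M"
  shows "(\<integral>\<^sup>+ \<omega>. f \<omega> \<partial>M) =
    (\<integral>\<^sup>+ u. emeasure M {\<omega>\<in>space M. ennreal u < f \<omega>} * indicator {0..} u \<partial>lborel)"
proof -
  interpret sigma_finite_measure M by fact
  interpret pair_sigma_finite M lborel ..
  have *: "f \<omega> = (\<integral>\<^sup>+ u. indicator {u. 0 \<le> u \<and> ennreal u < f \<omega>} u \<partial>lborel)" for \<omega>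
  proof (cases "f \<omega>")
    case (real r)
    then have "{u. 0 \<le> u \<and> ennreal u < f \<omega>} = {0..<r}" by (auto simp: ennreal_less_iff)
    then show ?thesis using real by simp
  next
    case top
    then have "{u. 0 \<le> u \<and> ennreal u < f \<omega>} = {0..}" by (auto simp: less_top[symmetric])
    moreover have "emeasure lborel {0::real..} = top"
    proof (rule ccontr)
      assume "emeasure lborel {0::real..} \<noteq> top"
      then obtain n where n: "emeasure lborel {0::real..} < of_nat n"
        using ennreal_Ex_less_of_nat by (auto simp: less_top)
      have "emeasure lborel {0..real n} \<le> emeasure lborel {0::real..}" by (intro emeasure_mono) auto
      then show False using n by (simp add: ennreal_of_nat_eq_real_of_nat)
    qed
    ultimately show ?thesis using top by simp
  qed
  have "(\<integral>\<^sup>+ \<omega>. f \<omega> \<partial>M) = (\<integral>\<^sup>+ \<omega>. (\<integral>\<^sup>+ u. indicator {u. 0 \<le> u \<and> ennreal u < f \<omega>} u \<partial>lborel) \<partial>M)"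
    using * by simp
  also have "\<dots> = (\<integral>\<^sup>+ u. (\<integral>\<^sup>+ \<omega>. indicator {u. 0 \<le> u \<and> ennreal u < f \<omega>} u \<partial>M) \<partial>lborel)"
    by (subst Fubini') (auto simp: indicator_def)
  also have "\<dots> = (\<integral>\<^sup>+ u. emeasure M {\<omega>\<in>space M. ennreal u < f \<omega>} * indicator {0..} u \<partial>lborel)"
  proof (rule nn_integral_cong)
    fix u :: real
    have "(\<integral>\<^sup>+ \<omega>. indicator {u. 0 \<le> u \<and> ennreal u < f \<omega>} u \<partial>M) =
        (\<integral>\<^sup>+ \<omega>. indicator {\<omega>\<in>space M. ennreal u < f \<omega>} \<omega> * indicator {0..} u \<partial>M)"
      by (intro nn_integral_cong) (auto simp: indicator_def)
    then show "(\<integral>\<^sup>+ \<omega>. indicator {u. 0 \<le> u \<and> ennreal u < f \<omega>} u \<partial>M) =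
        emeasure M {\<omega>\<in>space M. ennreal u < f \<omega>} * indicator {0..} u"
      by (simp add: nn_integral_multc)
  qed
  finally show ?thesis .
qed

text \<open>Only levels above \<open>2 * c\<close> are controlled; the levels below contribute at
  most \<open>2 * c\<close> to the layer cake integral. The factor 4 is the 2 of the tail bound
  times the 2 from rescaling \<open>u\<close> to \<open>2 * u\<close>.\<close>

lemma (in prob_space) nn_integral_le_of_tail_bound:
  fixes Z :: "'a \<Rightarrow> ennreal" and Y :: "'a \<Rightarrow> real"
  assumes [measurable]: "Z \<in> borel_measurable M" "Y \<in> borel_measurable M" and "0 \<le> c"
    and tail: "\<And>u. c \<le> u \<Longrightarrow>
      prob {\<omega>\<in>space M. ennreal (2 * u) < Z \<omega>} \<le> 2 * prob {\<omega>\<in>space M. u < \<bar>Y \<omega>\<bar>}"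
  shows "(\<integral>\<^sup>+ \<omega>. Z \<omega> \<partial>M) \<le> ennreal (2 * c) + 4 * (\<integral>\<^sup>+ \<omega>. ennreal \<bar>Y \<omega>\<bar> \<partial>M)"
proof -
  have sf: "sigma_finite_measure M" by unfold_locales
  have "(\<integral>\<^sup>+ \<omega>. Z \<omega> \<partial>M) = (\<integral>\<^sup>+ u. emeasure M {\<omega>\<in>space M. ennreal u < Z \<omega>} * indicator {0..} u \<partial>lborel)"
    by (intro nn_integral_layer_cake sf) measurable
  also have "\<dots> \<le> (\<integral>\<^sup>+ u. indicator {0..<2*c} u +
      2 * (emeasure M {\<omega>\<in>space M. ennreal u < ennreal (2 * \<bar>Y \<omega>\<bar>)} * indicator {0..} u) \<partial>lborel)"
  proof (intro nn_integral_mono)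
    fix u :: real
    consider "u < 0" | "0 \<le> u" "u < 2 * c" | "0 \<le> u" "c \<le> u / 2" by linarith
    then show "emeasure M {\<omega>\<in>space M. ennreal u < Z \<omega>} * indicator {0..} u \<le> indicator {0..<2*c} u +
      2 * (emeasure M {\<omega>\<in>space M. ennreal u < ennreal (2 * \<bar>Y \<omega>\<bar>)} * indicator {0..} u)"
    proof cases
      case 2
      then show ?thesis using emeasure_le_1[of "{\<omega>\<in>space M. ennreal u < Z \<omega>}"]
        by (auto intro: order_trans[OF _ le_add_same_cancel1[THEN iffD2]] simp: add_increasing2)
    next
      case 3
      have "{\<omega>\<in>space M. ennreal u < ennreal (2 * \<bar>Y \<omega>\<bar>)} = {\<omega>\<in>space M. u / 2 < \<bar>Y \<omega>\<bar>}"
        using 3 by (auto simp: ennreal_less_iff)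
      with tail[of "u/2"] 3 show ?thesis
        by (auto simp: emeasure_eq_measure indicator_def ennreal_mult'[symmetric] 
          ennreal_numeral[symmetric] simp del: ennreal_numeral intro!: ennreal_leI)
    qed simp
  qed
  also have "\<dots> = ennreal (2 * c) + 2 * (\<integral>\<^sup>+ \<omega>. ennreal (2 * \<bar>Y \<omega>\<bar>) \<partial>M)"
  proof -
    have m: "(\<lambda>u. emeasure M {\<omega>\<in>space M. ennreal u < ennreal (2 * \<bar>Y \<omega>\<bar>)}) \<in> borel_measurable lborel"
      by measurable
    have "(\<integral>\<^sup>+ \<omega>. ennreal (2 * \<bar>Y \<omega>\<bar>) \<partial>M) = (\<integral>\<^sup>+ u. emeasure M {\<omega>\<in>space M. ennreal u < ennreal (2 * \<bar>Y \<omega>\<bar>)} * indicator {0..} u \<partial>lborel)"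
      by (intro nn_integral_layer_cake sf) measurable
    with m \<open>0 \<le> c\<close> show ?thesis by (subst nn_integral_add) (auto simp: nn_integral_cmult)
  qed
  also have "(\<integral>\<^sup>+ \<omega>. ennreal (2 * \<bar>Y \<omega>\<bar>) \<partial>M) = 2 * (\<integral>\<^sup>+ \<omega>. ennreal \<bar>Y \<omega>\<bar> \<partial>M)"
    by (simp add: ennreal_mult' nn_integral_cmult)
  also have "2 * (2 * (\<integral>\<^sup>+ \<omega>. ennreal \<bar>Y \<omega>\<bar> \<partial>M)) = 4 * (\<integral>\<^sup>+ \<omega>. ennreal \<bar>Y \<omega>\<bar> \<partial>M)"
    by (simp add: mult.assoc[symmetric])
  finally show ?thesis .
qed

text \<open>Restricting to rational times keeps the suprema over random paths measurable.\<close>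

definition running_sup :: "(real \<Rightarrow> real) \<Rightarrow> real \<Rightarrow> ennreal" where
  "running_sup f T = (SUP r\<in>\<rat> \<inter> {0..T}. ennreal \<bar>f r\<bar>)"

section \<open>Cadlag paths and their values at rational times\<close>

lemma cadlag_local:
  fixes f :: "real \<Rightarrow> real"
  assumes rc: "\<And>t. 0 \<le> t \<Longrightarrow> continuous (at_right t) f"
    and ll: "\<And>t. 0 < t \<Longrightarrow> \<exists>l. (f \<longlongrightarrow> l) (at_left t)"
    and "0 \<le> t" "0 < e"
  obtains l d where "0 < d" "\<And>s. t \<le> s \<Longrightarrow> s < t + d \<Longrightarrow> \<bar>f s - f t\<bar> < e"
    "\<And>s. 0 \<le> s \<Longrightarrow> t - d < s \<Longrightarrow> s < t \<Longrightarrow> \<bar>f s - l\<bar> < e" "0 < t \<Longrightarrow> (f \<longlongrightarrow> l) (at_left t)"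
proof -
  have "(f \<longlongrightarrow> f t) (at_right t)" using rc[OF \<open>0 \<le> t\<close>] by (simp add: continuous_within)
  then have "eventually (\<lambda>s. \<bar>f s - f t\<bar> < e) (at_right t)"
    using \<open>0 < e\<close> by (simp add: tendsto_iff dist_real_def)
  then obtain b where b: "b > t" "\<And>s. t < s \<Longrightarrow> s < b \<Longrightarrow> \<bar>f s - f t\<bar> < e"
    by (auto simp: eventually_at_right_field)
  have R: "\<bar>f s - f t\<bar> < e" if "t \<le> s" "s < b" for s using b(2)[of s] that \<open>0 < e\<close> by (cases "s = t") auto
  show thesis
  proof (cases "t = 0")
    case True
    \<comment> \<open>At time 0 no \<open>s\<close> satisfies the clause on the left, so the limit
      is a dummy value.\<close>
    then show thesis using b R by (intro that[of "b - t" 0]) auto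
  next
    case False
    with \<open>0 \<le> t\<close> have t: "0 < t" by simp
    from ll[OF t] obtain l where l: "(f \<longlongrightarrow> l) (at_left t)" by auto
    then have "eventually (\<lambda>s. \<bar>f s - l\<bar> < e) (at_left t)"
      using \<open>0 < e\<close> by (simp add: tendsto_iff dist_real_def)
    then obtain a where a: "a < t" "\<And>s. a < s \<Longrightarrow> s < t \<Longrightarrow> \<bar>f s - l\<bar> < e"
      by (auto simp: eventually_at_left_field)
    show thesis using a b R l by (intro that[of "min (t - a) (b - t)" l]) auto
  qed
qed

lemma cadlag_bounded:
  fixes f :: "real \<Rightarrow> real"
  assumes rc: "\<And>t. 0 \<le> t \<Longrightarrow> continuous (at_right t) f"
    and ll: "\<And>t. 0 < t \<Longrightarrow> \<exists>l. (f \<longlongrightarrow> l) (at_left t)"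
  shows "\<exists>B. \<forall>s\<in>{0..T}. \<bar>f s\<bar> \<le> B"
proof -
  have "\<exists>d B. 0 < d \<and> (\<forall>s\<ge>0. t - d < s \<longrightarrow> s < t + d \<longrightarrow> \<bar>f s\<bar> \<le> B)" if t: "0 \<le> t" for t
  proof -
    obtain l d where d: "0 < d" "\<And>s. t \<le> s \<Longrightarrow> s < t + d \<Longrightarrow> \<bar>f s - f t\<bar> < 1"
      "\<And>s. 0 \<le> s \<Longrightarrow> t - d < s \<Longrightarrow> s < t \<Longrightarrow> \<bar>f s - l\<bar> < 1" "0 < t \<Longrightarrow> (f \<longlongrightarrow> l) (at_left t)"
      using cadlag_local[OF rc ll t zero_less_one] by metis
    have "\<bar>f s\<bar> \<le> \<bar>f t\<bar> + \<bar>l\<bar> + 1" if "0 \<le> s" "t - d < s" "s < t + d" for s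
      using d(2)[of s] d(3)[of s] that by (cases "t \<le> s") auto
    then show ?thesis using d(1) by blast
  qed
  then obtain d B where d: "\<And>t. 0 \<le> t \<Longrightarrow> 0 < d t"
      "\<And>t s. 0 \<le> t \<Longrightarrow> 0 \<le> s \<Longrightarrow> t - d t < s \<Longrightarrow> s < t + d t \<Longrightarrow> \<bar>f s\<bar> \<le> B t" by metis
  obtain C where C: "C \<subseteq> {0..T}" "finite C" "{0..T} \<subseteq> (\<Union>t\<in>C. {t - d t<..<t + d t})"
  proof (rule compactE_image[of "{0..T}" "{0..T}" "\<lambda>t. {t - d t<..<t + d t}"])
    show "{0..T} \<subseteq> (\<Union>t\<in>{0..T}. {t - d t<..<t + d t})" using d(1) by force
  qed auto
  have "\<bar>f s\<bar> \<le> (\<Sum>t\<in>C. \<bar>B t\<bar>)" if s: "s \<in> {0..T}" for s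
  proof -
    obtain t where t: "t \<in> C" "s \<in> {t - d t<..<t + d t}" using C(3) s by auto
    then have "\<bar>f s\<bar> \<le> \<bar>B t\<bar>" using d(2)[of t s] C(1) s by force
    also have "\<dots> \<le> (\<Sum>t\<in>C. \<bar>B t\<bar>)" using t C(2) by (intro member_le_sum) auto
    finally show ?thesis .
  qed
  then show ?thesis by blast
qed

lemma running_sup_mono: "S \<le> T \<Longrightarrow> running_sup f S \<le> running_sup f T"
  unfolding running_sup_def by (intro SUP_subset_mono) auto

text \<open>By right continuity the value at \<open>s\<close> is a limit of values at rationals to
  the right of \<open>s\<close>. The bound \<open>T\<close> confines these rationals to the interval
  where membership is known.\<close>

lemma right_limit_mem_closed:
  fixes f :: "real \<Rightarrow> real"
  assumes "continuous (at_right s) f" "s < T" "\<And>r. r \<in> \<rat> \<Longrightarrow> s < r \<Longrightarrow> r < T \<Longrightarrow> f r \<in> A" "closed A"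
  shows "f s \<in> A"
proof (rule ccontr)
  assume "f s \<notin> A"
  have "(f \<longlongrightarrow> f s) (at_right s)" using assms(1) by (simp add: continuous_within)
  then have "eventually (\<lambda>r. f r \<in> - A) (at_right s)"
    using \<open>f s \<notin> A\<close> \<open>closed A\<close> by (intro topological_tendstoD) auto
  then obtain b where b: "b > s" "\<And>r. s < r \<Longrightarrow> r < b \<Longrightarrow> f r \<notin> A"
    by (auto simp: eventually_at_right_field)
  obtain r where "r \<in> \<rat>" "s < r" "r < min b T" using Rats_dense_in_real[of s "min b T"] b(1) assms(2) by auto
  then show False using assms(3)[of r] b(2)[of r] by auto
qed

text \<open>The strict inequality \<open>s < T\<close> leaves rationals between \<open>s\<close> and
  \<open>T\<close>; later horizons carry some slack for this reason.\<close>

lemma abs_le_running_sup: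
  assumes rc: "continuous (at_right s) f" and s: "0 \<le> s" "s < T"
  shows "ennreal \<bar>f s\<bar> \<le> running_sup f T"
proof (cases "running_sup f T")
  case (real B)
  have "f s \<in> {-B..B}"
  proof (rule right_limit_mem_closed[OF rc s(2)])
    fix r assume r: "r \<in> \<rat>" "s < r" "r < T"
    then have "ennreal \<bar>f r\<bar> \<le> running_sup f T"
      unfolding running_sup_def using s by (intro SUP_upper) auto
    with real have "\<bar>f r\<bar> \<le> B" by simp
    then show "f r \<in> {-B..B}" by auto
  qed auto
  then show ?thesis using real by (auto intro!: ennreal_leI)
qed simp

lemma running_sup_finite:
  fixes f :: "real \<Rightarrow> real"
  assumes "\<And>t. 0 \<le> t \<Longrightarrow> continuous (at_right t) f" "\<And>t. 0 < t \<Longrightarrow> \<exists>l. (f \<longlongrightarrow> l) (at_left t)"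
  shows "running_sup f T < top"
proof -
  obtain B where "\<And>s. s \<in> {0..T} \<Longrightarrow> \<bar>f s\<bar> \<le> B" using cadlag_bounded[OF assms] by blast
  then have "running_sup f T \<le> ennreal B"
    unfolding running_sup_def by (intro SUP_least ennreal_leI) auto
  then show ?thesis by (rule le_less_trans) simp
qed

section \<open>The running supremum of a Levy process\<close>

context levy_process
begin

lemma running_sup_measurable[measurable]: "(\<lambda>\<omega>. running_sup (\<lambda>t. X t \<omega>) T) \<in> borel_measurable M"
  unfolding running_sup_def
  using levy_measurable by (intro borel_measurable_SUP) (auto intro: countable_subset[OF _ countable_rat])

lemma prob_abs_increment:
  assumes "0 \<le> s" "s \<le> t"
  shows "prob {\<omega>\<in>space M. c < \<bar>X t \<omega> - X s \<omega>\<bar>} = prob {\<omega>\<in>space M. c < \<bar>X (t - s) \<omega>\<bar>}"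
proof -
  have [measurable]: "X t \<in> borel_measurable M" "X s \<in> borel_measurable M" "X (t - s) \<in> borel_measurable M"
    using assms by (auto intro: levy_measurable)
  have "measure (distr M borel (\<lambda>\<omega>. X t \<omega> - X s \<omega>)) {x. c < \<bar>x\<bar>} = measure (distr M borel (X (t - s))) {x. c < \<bar>x\<bar>}"
    by (simp add: levy_stationary_increments[OF assms])
  then show ?thesis
    by (simp add: measure_distr vimage_def Int_def conj_commute)
qed

lemma nn_integral_abs_increment:
  assumes "0 \<le> s" "s \<le> t"
  shows "(\<integral>\<^sup>+ \<omega>. ennreal \<bar>X t \<omega> - X s \<omega>\<bar> \<partial>M) = (\<integral>\<^sup>+ \<omega>. ennreal \<bar>X (t - s) \<omega>\<bar> \<partial>M)"
proof -
  have [measurable]: "X t \<in> borel_measurable M" "X s \<in> borel_measurable M" "X (t - s) \<in> borel_measurable M"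
    using assms by (auto intro: levy_measurable)
  have "(\<integral>\<^sup>+ y. ennreal \<bar>y\<bar> \<partial>distr M borel (\<lambda>\<omega>. X t \<omega> - X s \<omega>)) = (\<integral>\<^sup>+ y. ennreal \<bar>y\<bar> \<partial>distr M borel (X (t - s)))"
    by (simp add: levy_stationary_increments[OF assms])
  then show ?thesis by (simp add: nn_integral_distr)
qed

text \<open>Ottaviani's inequality on finer and finer grids. Stationarity turns the hypothesis on
  \<open>X s\<close> into the one on the increments that remain after a grid time. The grids exhaust
  the rational times, which are all that \<open>running_sup\<close> sees.\<close>

lemma running_sup_tail:
  assumes c: "0 \<le> c" and half: "\<And>s. 0 \<le> s \<Longrightarrow> s \<le> real N \<Longrightarrow> prob {\<omega>\<in>space M. c < \<bar>X s \<omega>\<bar>} \<le> 1/2"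
    and N: "0 < N"
  shows "prob {\<omega>\<in>space M. ennreal (2 * c) < running_sup (\<lambda>t. X t \<omega>) N} \<le> 2 * prob {\<omega>\<in>space M. c < \<bar>X N \<omega>\<bar>}"
proof -
  \<comment> \<open>Factorial denominators make the grids nested, so that the events
    \<open>A m\<close> increase, and every rational \<open>r\<close> in \<open>{0..N}\<close> lies
    on one of them: if \<open>r / N = a / b\<close>, then \<open>b\<close> divides
    \<open>fact b\<close>.\<close>
  define t where "t m i = real i * real N / fact m" for m i :: nat
  have t0: "0 \<le> t m i" for m i by (simp add: t_def)
  have tN: "t m (fact m) = N" for m by (simp add: t_def)
  have tmono: "incseq (t m)" for m unfolding t_def by (intro monoI divide_right_mono mult_right_mono) auto
  have [measurable]: "X (t m i) \<in> borel_measurable M" "X 0 \<in> borel_measurable M" "X N \<in> borel_measurable M" for m i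
    using t0 by (auto intro: levy_measurable)
  define A where "A m = {\<omega>\<in>space M. \<exists>k\<le>fact m. 2 * c < \<bar>X (t m k) \<omega> - X 0 \<omega>\<bar>}" for m
  have Am: "A m \<in> sets M" for m unfolding A_def by measurable
  have diff: "prob {\<omega>\<in>space M. c < \<bar>X N \<omega> - X 0 \<omega>\<bar>} = prob {\<omega>\<in>space M. c < \<bar>X N \<omega>\<bar>}"
    using prob_abs_increment[of 0 N c] by simp
  have PA: "prob (A m) \<le> 2 * prob {\<omega>\<in>space M. c < \<bar>X N \<omega>\<bar>}" for m
  proof -
    let ?Y = "\<lambda>i \<omega>. X (t m (Suc i)) \<omega> - X (t m i) \<omega>"
    have iv: "indep_vars (\<lambda>_. borel) ?Y {..<fact m}"
      using t0 tmono by (intro levy_indep_increments)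
    have tele: "(\<Sum>i=k..<n. ?Y i \<omega>) = X (t m n) \<omega> - X (t m k) \<omega>" if "k \<le> n" for k n \<omega>
      using sum_Suc_diff'[of k n "\<lambda>i. X (t m i) \<omega>"] that by simp
    have tele0: "(\<Sum>i<k. ?Y i \<omega>) = X (t m k) \<omega> - X 0 \<omega>" for k \<omega>
      using tele[of 0 k \<omega>] by (simp add: atLeast0LessThan t_def)
    have "prob {\<omega>\<in>space M. \<exists>k\<le>fact m. 2 * c < \<bar>\<Sum>i<k. ?Y i \<omega>\<bar>}
        \<le> 2 * prob {\<omega>\<in>space M. c < \<bar>\<Sum>i<fact m. ?Y i \<omega>\<bar>}"
    proof (rule ottaviani_inequality[OF iv])
      fix k :: nat assume k: "k \<le> fact m"
      have le: "t m k \<le> N" using monoD[OF tmono[of m] k] tN[of m] by simp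
      have "prob {\<omega>\<in>space M. c < \<bar>\<Sum>i=k..<fact m. ?Y i \<omega>\<bar>} = prob {\<omega>\<in>space M. c < \<bar>X N \<omega> - X (t m k) \<omega>\<bar>}"
        using tele[OF k] by (simp add: tN)
      also have "\<dots> = prob {\<omega>\<in>space M. c < \<bar>X (N - t m k) \<omega>\<bar>}"
        by (intro prob_abs_increment t0 le)
      also have "\<dots> \<le> 1/2" using t0[of m k] le by (intro half) auto
      finally show "prob {\<omega>\<in>space M. c < \<bar>\<Sum>i=k..<fact m. ?Y i \<omega>\<bar>} \<le> 1/2" .
    qed
    then show ?thesis using diff by (simp add: tele0 tN A_def)
  qed
  have inc: "incseq A"
  proof (rule incseq_SucI, safe)
    fix m \<omega> assume "\<omega> \<in> A m"
    then obtain k where k: "\<omega> \<in> space M" "k \<le> fact m" "2 * c < \<bar>X (t m k) \<omega> - X 0 \<omega>\<bar>" unfolding A_def by auto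
    have "t (Suc m) (Suc m * k) = t m k" by (simp add: t_def mult.assoc del: of_nat_Suc mult_Suc)
    moreover have "Suc m * k \<le> fact (Suc m)" using k(2) by (simp del: mult_Suc)
    ultimately show "\<omega> \<in> A (Suc m)" using k unfolding A_def by (auto intro!: exI[of _ "Suc m * k"] simp del: mult_Suc fact_Suc)
  qed
  have sub: "\<omega> \<in> (\<Union>m. A m)" if w: "\<omega> \<in> space M" "ennreal (2 * c) < running_sup (\<lambda>t. X t \<omega>) N" "X 0 \<omega> = 0" for \<omega>
  proof -
    from w(2) obtain r where r: "r \<in> \<rat>" "0 \<le> r" "r \<le> real N" "ennreal (2 * c) < ennreal \<bar>X r \<omega>\<bar>"
      unfolding running_sup_def less_SUP_iff by auto
    have r4: "2 * c < \<bar>X r \<omega>\<bar>" using r(4) c by (simp add: ennreal_less_iff)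
    have "r / N \<in> \<rat>" using r(1) by simp
    then obtain a b :: nat where ab: "b \<noteq> 0" "\<bar>r / N\<bar> = real a / real b" by (metis Rats_abs_nat_div_natE)
    have dv: "b dvd fact b" using ab(1) by (intro dvd_fact) auto
    then obtain d where d: "fact b = b * d" by auto
    have d0: "d \<noteq> 0" using d by (metis fact_nonzero mult_0_right)
    have req: "r = real a * N / b" using ab r(2) N by (simp add: field_simps)
    have "(fact b :: real) = real b * real d" using d by (metis of_nat_fact of_nat_mult)
    then have "t b (a * d) = r" using ab(1) d0 unfolding t_def req by simp
    moreover have "a * d \<le> fact b"
    proof -
      have "real a \<le> real b" using r(3) N ab(1) unfolding req by (simp add: field_simps)
      then show ?thesis unfolding d by simp
    qed
    ultimately have "\<omega> \<in> A b" using w r4 unfolding A_def by (auto intro!: exI[of _ "a * d"])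
    then show ?thesis by auto
  qed
  have "prob {\<omega>\<in>space M. ennreal (2 * c) < running_sup (\<lambda>t. X t \<omega>) N} \<le> prob (\<Union>m. A m)"
  proof (rule finite_measure_mono_AE)
    show "AE \<omega> in M. \<omega> \<in> {\<omega>\<in>space M. ennreal (2 * c) < running_sup (\<lambda>t. X t \<omega>) N} \<longrightarrow> \<omega> \<in> (\<Union>m. A m)"
      using levy_start by eventually_elim (use sub in blast)
  qed (use Am in blast)
  also have "\<dots> \<le> 2 * prob {\<omega>\<in>space M. c < \<bar>X N \<omega>\<bar>}"
  proof (rule LIMSEQ_le_const2)
    show "(\<lambda>m. prob (A m)) \<longlonglongrightarrow> prob (\<Union>m. A m)"
      using Am inc by (intro finite_Lim_measure_incseq) auto
  qed (use PA in auto)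
  finally show ?thesis .
qed

lemma running_sup_finite_AE: "AE \<omega> in M. running_sup (\<lambda>t. X t \<omega>) T < top"
  using levy_right_continuous levy_left_limits
  by eventually_elim (rule running_sup_finite; blast)

text \<open>One level has to serve all \<open>s\<close> up to 1. The tails of the almost surely
  finite supremum over \<open>{0..2}\<close> tend to 0 and dominate the tail of each such
  \<open>X s\<close>.\<close>

lemma exists_half_tail: "\<exists>c\<ge>0. \<forall>s. 0 \<le> s \<longrightarrow> s \<le> 1 \<longrightarrow> prob {\<omega>\<in>space M. c < \<bar>X s \<omega>\<bar>} \<le> 1/2"
proof -
  let ?Z = "\<lambda>\<omega>. running_sup (\<lambda>t. X t \<omega>) 2"
  let ?A = "\<lambda>n. {\<omega>\<in>space M. of_nat n < ?Z \<omega>}"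
  have "(\<lambda>n. prob (?A n)) \<longlonglongrightarrow> prob (\<Inter>n. ?A n)"
    by (intro finite_Lim_measure_decseq decseq_SucI) (auto intro: le_less_trans[rotated])
  also have "prob (\<Inter>n. ?A n) = 0"
  proof -
    have "AE \<omega> in M. \<omega> \<notin> (\<Inter>n. ?A n)"
      using running_sup_finite_AE[of 2]
    proof eventually_elim
      case (elim \<omega>)
      then obtain n where "?Z \<omega> < of_nat n" using ennreal_Ex_less_of_nat by blast
      then show ?case by (auto intro!: exI[of _ n])
    qed
    then show ?thesis by (subst prob_eq_0) auto
  qed
  finally have "eventually (\<lambda>n. prob (?A n) < 1/2) sequentially" by (rule order_tendstoD) simp
  then obtain n where n: "prob (?A n) < 1/2" by (auto simp: eventually_sequentially)
  have "prob {\<omega>\<in>space M. real n < \<bar>X s \<omega>\<bar>} \<le> 1/2" if s: "0 \<le> s" "s \<le> 1" for s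
  proof -
    have [measurable]: "X s \<in> borel_measurable M" using s by (intro levy_measurable)
    have "prob {\<omega>\<in>space M. real n < \<bar>X s \<omega>\<bar>} \<le> prob (?A n)"
    proof (rule finite_measure_mono_AE)
      show "AE \<omega> in M. \<omega> \<in> {\<omega>\<in>space M. real n < \<bar>X s \<omega>\<bar>} \<longrightarrow> \<omega> \<in> ?A n"
        using levy_right_continuous
      proof eventually_elim
        case (elim \<omega>)
        then have "ennreal \<bar>X s \<omega>\<bar> \<le> ?Z \<omega>" using s by (intro abs_le_running_sup) auto
        then show ?case
          by (auto simp: ennreal_of_nat_eq_real_of_nat ennreal_less_iff elim!: less_le_trans[rotated])
      qed
    qed auto
    with n show ?thesis by simp
  qed
  then show ?thesis by (intro exI[of _ "real n"]) auto
qed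

text \<open>The maximal inequality is used twice. On the unit interval it makes the supremum
  integrable, with mean \<open>K\<close>. By subadditivity the mean of
  \<open>\<bar>X s\<bar>\<close> then grows at most linearly, and Markov's inequality yields a
  level, linear in \<open>N\<close>, that each \<open>X s\<close> with \<open>s \<le> N\<close>
  exceeds in modulus with probability at most 1/2. This is what the second use, on
  \<open>{0..N}\<close>, requires.\<close>

lemma expected_running_sup_linear:
  assumes int: "integrable M (X 1)"
  shows "\<exists>C\<ge>0. \<forall>N::nat. (\<integral>\<^sup>+ \<omega>. running_sup (\<lambda>t. X t \<omega>) N \<partial>M) \<le> ennreal (C * (1 + N))"
proof -
  have m[measurable]: "X s \<in> borel_measurable M" if "0 \<le> s" for s using that by (rule levy_measurable)
  obtain c where c: "0 \<le> c" "\<And>s. 0 \<le> s \<Longrightarrow> s \<le> 1 \<Longrightarrow> prob {\<omega>\<in>space M. c < \<bar>X s \<omega>\<bar>} \<le> 1/2"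
    using exists_half_tail by blast
  define Z where "Z N \<omega> = running_sup (\<lambda>t. X t \<omega>) (real N)" for N \<omega>
  have Zm[measurable]: "Z N \<in> borel_measurable M" for N unfolding Z_def by simp
  have Z: "(\<integral>\<^sup>+ \<omega>. Z N \<omega> \<partial>M) \<le> ennreal (2 * c) + 4 * (\<integral>\<^sup>+ \<omega>. ennreal \<bar>X N \<omega>\<bar> \<partial>M)"
    if c: "0 \<le> c" and N: "0 < N" and half: "\<And>s. 0 \<le> s \<Longrightarrow> s \<le> real N \<Longrightarrow> prob {\<omega>\<in>space M. c < \<bar>X s \<omega>\<bar>} \<le> 1/2" for c N
  proof (rule nn_integral_le_of_tail_bound[OF _ _ c])
    fix u assume u: "c \<le> u"
    show "prob {\<omega>\<in>space M. ennreal (2 * u) < Z N \<omega>} \<le> 2 * prob {\<omega>\<in>space M. u < \<bar>X N \<omega>\<bar>}"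
      unfolding Z_def
    proof (rule running_sup_tail[OF _ _ N])
      fix s assume s: "0 \<le> s" "s \<le> real N"
      have "prob {\<omega>\<in>space M. u < \<bar>X s \<omega>\<bar>} \<le> prob {\<omega>\<in>space M. c < \<bar>X s \<omega>\<bar>}"
        using u m[OF s(1)] by (intro finite_measure_mono) auto
      then show "prob {\<omega>\<in>space M. u < \<bar>X s \<omega>\<bar>} \<le> 1/2" using half[OF s] by simp
    qed (use c u in auto)
  qed auto
  have fin1: "(\<integral>\<^sup>+ \<omega>. ennreal \<bar>X 1 \<omega>\<bar> \<partial>M) < top" using int by (simp add: integrable_iff_bounded)
  have "(\<integral>\<^sup>+ \<omega>. Z 1 \<omega> \<partial>M) < top"
    using Z[of c 1] c fin1 by (auto intro: le_less_trans simp: ennreal_mult_less_top)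
  then obtain K where K: "0 \<le> K" "(\<integral>\<^sup>+ \<omega>. Z 1 \<omega> \<partial>M) = ennreal K" by (cases "\<integral>\<^sup>+ \<omega>. Z 1 \<omega> \<partial>M") auto
  have "AE \<omega> in M. ennreal \<bar>X s \<omega>\<bar> \<le> Z 1 \<omega>" if s: "0 \<le> s" "s < 1" for s
    using levy_right_continuous unfolding Z_def
    by eventually_elim (use s in \<open>auto intro!: abs_le_running_sup\<close>)
  then have le1: "(\<integral>\<^sup>+ \<omega>. ennreal \<bar>X s \<omega>\<bar> \<partial>M) \<le> ennreal K" if "0 \<le> s" "s < 1" for s
    using that unfolding K(2)[symmetric] by (intro nn_integral_mono_AE) auto
  have EX: "(\<integral>\<^sup>+ \<omega>. ennreal \<bar>X s \<omega>\<bar> \<partial>M) \<le> ennreal (real n * K)" if s: "0 \<le> s" "s < n" for n s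
    using s
  proof (induction n arbitrary: s)
    case (Suc n)
    show ?case
    proof (cases n)
      case 0 then show ?thesis using le1[of s] Suc.prems by simp
    next
      case (Suc k)
      \<comment> \<open>Splitting in this proportion keeps both inequalities strict: the first piece
        is shorter than 1 and the rest is shorter than \<open>n\<close>.\<close>
      define h where "h = s / real (Suc n)"
      have h: "0 \<le> h" "h < 1" "h \<le> s" "s - h < n" 
      proof -
        have "s * n < real (Suc n) * n" using Suc.prems \<open>n = Suc k\<close> by (intro mult_strict_right_mono) auto
        then show "s - h < n" using Suc.prems unfolding h_def by (simp add: field_simps)
      qed (use Suc.prems in \<open>auto simp: h_def field_simps\<close>)
      have "(\<integral>\<^sup>+ \<omega>. ennreal \<bar>X s \<omega>\<bar> \<partial>M) \<le> (\<integral>\<^sup>+ \<omega>. ennreal \<bar>X h \<omega>\<bar> + ennreal \<bar>X s \<omega> - X h \<omega>\<bar> \<partial>M)"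
        by (intro nn_integral_mono) (auto simp: ennreal_plus[symmetric] simp del: ennreal_plus intro!: ennreal_leI)
      also have "\<dots> = (\<integral>\<^sup>+ \<omega>. ennreal \<bar>X h \<omega>\<bar> \<partial>M) + (\<integral>\<^sup>+ \<omega>. ennreal \<bar>X s \<omega> - X h \<omega>\<bar> \<partial>M)"
        using m[OF h(1)] m[OF Suc.prems(1)] by (intro nn_integral_add) auto
      also have "\<dots> \<le> ennreal K + ennreal (real n * K)"
        using h Suc.prems by (subst nn_integral_abs_increment) (auto intro!: add_mono le1 Suc.IH)
      also have "\<dots> = ennreal (real (Suc n) * K)" using K(1) by (simp add: ennreal_plus[symmetric] algebra_simps del: ennreal_plus)
      finally show ?thesis .
    qed
  qed simp
  have "(\<integral>\<^sup>+ \<omega>. Z N \<omega> \<partial>M) \<le> ennreal ((8 * (K + 1)) * (1 + N))" for N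
  proof (cases "N = 0")
    case True
    have "(\<integral>\<^sup>+ \<omega>. Z N \<omega> \<partial>M) \<le> (\<integral>\<^sup>+ \<omega>. Z 1 \<omega> \<partial>M)"
      unfolding Z_def True by (intro nn_integral_mono running_sup_mono) auto
    also have "\<dots> \<le> ennreal ((8 * (K + 1)) * (1 + N))" unfolding K(2) True using K(1) by (intro ennreal_leI) auto
    finally show ?thesis .
  next
    case False
    \<comment> \<open>Twice the mean bound of \<open>EXN\<close>, so that Markov's inequality gives
      exactly 1/2; \<open>K + 1\<close> in place of \<open>K\<close> keeps the level
      positive.\<close>
    define c where "c = 2 * (K + 1) * (1 + N)"
    have c0: "0 < c" using K(1) by (simp add: c_def)
    have EXN: "(\<integral>\<^sup>+ \<omega>. ennreal \<bar>X s \<omega>\<bar> \<partial>M) \<le> ennreal ((1 + N) * (K+1))" if "0 \<le> s" "s \<le> real N" for s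
    proof -
      have "(\<integral>\<^sup>+ \<omega>. ennreal \<bar>X s \<omega>\<bar> \<partial>M) \<le> ennreal (real (Suc N) * K)" using that by (intro EX) auto
      also have "\<dots> \<le> ennreal ((1 + N) * (K+1))" by (intro ennreal_leI) (auto intro!: mult_left_mono)
      finally show ?thesis .
    qed
    have "(\<integral>\<^sup>+ \<omega>. Z N \<omega> \<partial>M) \<le> ennreal (2 * c) + 4 * (\<integral>\<^sup>+ \<omega>. ennreal \<bar>X N \<omega>\<bar> \<partial>M)"
    proof (rule Z)
      fix s assume s: "0 \<le> s" "s \<le> real N"
      have mm[measurable]: "X s \<in> borel_measurable M" using s(1) by (rule m)
      have "{\<omega>\<in>space M. c < \<bar>X s \<omega>\<bar>} \<subseteq> {\<omega>\<in>space M. 1 \<le> ennreal (1/c) * ennreal \<bar>X s \<omega>\<bar>} \<inter> space M"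
        using c0 by (auto simp: ennreal_mult'[symmetric] ennreal_ge_1 field_simps)
      then have "emeasure M {\<omega>\<in>space M. c < \<bar>X s \<omega>\<bar>} \<le> emeasure M ({\<omega>\<in>space M. 1 \<le> ennreal (1/c) * ennreal \<bar>X s \<omega>\<bar>} \<inter> space M)"
        by (intro emeasure_mono) auto
      also have "{\<omega>\<in>space M. 1 \<le> ennreal (1/c) * ennreal \<bar>X s \<omega>\<bar>} \<inter> space M = {\<omega>\<in>space M. 1 \<le> ennreal (1/c) * ennreal \<bar>X s \<omega>\<bar>}" by auto
      also have "emeasure M \<dots> \<le> ennreal (1/c) * (\<integral>\<^sup>+ \<omega>. ennreal \<bar>X s \<omega>\<bar> * indicator (space M) \<omega> \<partial>M)"
        using nn_integral_Markov_inequality[of "\<lambda>\<omega>. ennreal \<bar>X s \<omega>\<bar>" "space M" M "ennreal (1/c)"] by simp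
      also have "\<dots> = ennreal (1/c) * (\<integral>\<^sup>+ \<omega>. ennreal \<bar>X s \<omega>\<bar> \<partial>M)"
        by (intro arg_cong2[where f="(*)"] nn_integral_cong) auto
      also have "\<dots> \<le> ennreal (1/c) * ennreal ((1 + N) * (K+1))" by (intro mult_left_mono EXN s) auto
      also have "\<dots> = ennreal (1/2)"
      proof -
        have "(1 + N) * (K + 1) = c / 2" by (simp add: c_def)
        then have *: "ennreal ((1 + N) * (K + 1)) = ennreal (c / 2)" by (rule arg_cong)
        have "ennreal (1 / c) * ennreal (c / 2) = ennreal (1 / c * (c / 2))"
          using c0 by (intro ennreal_mult'[symmetric]) simp
        then show ?thesis unfolding * using c0 by simp
      qed
      finally have "ennreal (prob {\<omega>\<in>space M. c < \<bar>X s \<omega>\<bar>}) \<le> ennreal (1/2)"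
        by (simp only: emeasure_eq_measure)
      then show "prob {\<omega>\<in>space M. c < \<bar>X s \<omega>\<bar>} \<le> 1/2" by (subst (asm) ennreal_le_iff) auto
    qed (use c0 False in auto)
    also have "\<dots> \<le> ennreal (2 * c) + 4 * ennreal ((1 + N) * (K+1))"
      by (intro add_mono mult_left_mono EXN) auto
    also have "\<dots> = ennreal (2 * c + 4 * ((1 + N) * (K+1)))"
      using c0 K(1) by (subst ennreal_plus) (auto simp: ennreal_mult' )
    also have "2 * c + 4 * ((1 + N) * (K+1)) = (8 * (K + 1)) * (1 + N)" by (simp add: c_def algebra_simps)
    finally show ?thesis .
  qed
  then show ?thesis using K(1) unfolding Z_def by (intro exI[of _ "8 * (K + 1)"]) auto
qed

end

subsection \<open>Paths without negative jumps\<close>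

text \<open>Collects the almost sure properties of the sample paths, so that strategies can be
  compared by deterministic arguments on one path. The clause \<open>l \<le> f t\<close> is the
  absence of negative jumps.\<close>

definition upward_cadlag :: "(real \<Rightarrow> real) \<Rightarrow> bool" where
  "upward_cadlag f \<longleftrightarrow> f 0 = 0 \<and> (\<forall>t\<ge>0. continuous (at_right t) f) \<and>
     (\<forall>t>0. \<exists>l. (f \<longlongrightarrow> l) (at_left t) \<and> l \<le> f t)"

lemma upward_cadlagD:
  assumes "upward_cadlag f"
  shows "f 0 = 0" "\<And>t. 0 \<le> t \<Longrightarrow> continuous (at_right t) f"
    "\<And>t. 0 < t \<Longrightarrow> \<exists>l. (f \<longlongrightarrow> l) (at_left t)"
    "\<And>t l. 0 < t \<Longrightarrow> (f \<longlongrightarrow> l) (at_left t) \<Longrightarrow> l \<le> f t"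
  using assms unfolding upward_cadlag_def
  by (auto dest: tendsto_unique[OF trivial_limit_at_left_real])

lemma left_value_eq:
  assumes "0 < t" "(f \<longlongrightarrow> l) (at_left t)"
  shows "left_value z f t = l"
  using assms by (auto simp: left_value_def intro!: tendsto_Lim)

lemma (in spectrally_positive_levy_process) AE_upward_cadlag: "AE \<omega> in M. upward_cadlag (\<lambda>t. X t \<omega>)"
  using levy_start levy_right_continuous levy_left_limits no_negative_jumps
proof eventually_elim
  case (elim \<omega>)
  have "\<exists>l. ((\<lambda>t. X t \<omega>) \<longlongrightarrow> l) (at_left t) \<and> l \<le> X t \<omega>" if t: "0 < t" for t
  proof -
    obtain l where l: "((\<lambda>t. X t \<omega>) \<longlongrightarrow> l) (at_left t)" using elim t by blast
    have "0 \<le> jump 0 (\<lambda>t. X t \<omega>) t" using elim t by blast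
    then show ?thesis using l left_value_eq[OF t l] by (auto simp: jump_def)
  qed
  with elim show ?case by (auto simp: upward_cadlag_def)
qed

text \<open>A one-sided modulus of continuity: the largest decrease over a time span of at most
  \<open>d\<close>. Rises count as 0 through \<open>ennreal\<close>, so upward jumps do not
  contribute; rational pairs keep it measurable.\<close>

definition drawdown :: "(real \<Rightarrow> real) \<Rightarrow> real \<Rightarrow> real \<Rightarrow> ennreal" where
  "drawdown f d T = (SUP p \<in> {p \<in> \<rat> \<times> \<rat>. 0 \<le> fst p \<and> fst p \<le> snd p \<and> snd p \<le> T \<and> snd p - fst p \<le> d}.
     ennreal (f (fst p) - f (snd p)))"

lemma (in levy_process) drawdown_measurable[measurable]:
  "(\<lambda>\<omega>. drawdown (\<lambda>t. X t \<omega>) d T) \<in> borel_measurable M"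
  unfolding drawdown_def
proof (intro borel_measurable_SUP)
  show "countable {p \<in> \<rat> \<times> \<rat>. 0 \<le> fst p \<and> fst p \<le> snd p \<and> snd p \<le> T \<and> snd p - fst p \<le> d}"
    by (rule countable_subset[of _ "\<rat> \<times> \<rat>"]) (auto intro: countable_rat)
  fix p :: "real \<times> real"
  assume "p \<in> {p \<in> \<rat> \<times> \<rat>. 0 \<le> fst p \<and> fst p \<le> snd p \<and> snd p \<le> T \<and> snd p - fst p \<le> d}"
  then have [measurable]: "X (fst p) \<in> borel_measurable M" "X (snd p) \<in> borel_measurable M"
    by (auto intro!: levy_measurable)
  show "(\<lambda>\<omega>. ennreal (X (fst p) \<omega> - X (snd p) \<omega>)) \<in> borel_measurable M" by measurable
qed

lemma drawdown_le_running_sup: "drawdown f d T \<le> 2 * running_sup f T"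
  unfolding drawdown_def
proof (intro SUP_least, clarsimp)
  fix r s assume rs: "r \<in> \<rat>" "s \<in> \<rat>" "0 \<le> r" "r \<le> s" "s \<le> T"
  have "ennreal (f r - f s) \<le> ennreal (\<bar>f r\<bar> + \<bar>f s\<bar>)" by (intro ennreal_leI) auto
  also have "\<dots> = ennreal \<bar>f r\<bar> + ennreal \<bar>f s\<bar>" by simp
  also have "\<dots> \<le> running_sup f T + running_sup f T"
    unfolding running_sup_def using rs by (intro add_mono SUP_upper) auto
  finally show "ennreal (f r - f s) \<le> 2 * running_sup f T" by (simp add: mult_2)
qed

text \<open>Both times are moved slightly to the right to become rational, first \<open>r\<close>
  and then \<open>s\<close>. Since \<open>s - r < d\<close> is strict, the moved \<open>s\<close>
  can stay within distance \<open>d\<close> of the moved \<open>r\<close>.\<close>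

lemma diff_le_drawdown:
  assumes rc: "\<And>t. 0 \<le> t \<Longrightarrow> continuous (at_right t) f"
    and rs: "0 \<le> r" "r \<le> s" "s - r < d" "s < T"
  shows "ennreal (f r - f s) \<le> drawdown f d T"
proof (cases "r = s")
  case False
  with rs have less: "r < s" by simp
  show ?thesis
  proof (cases "drawdown f d T")
    case (real B)
    have "f r \<in> {..f s + B}"
    proof (rule right_limit_mem_closed[OF rc, of r s])
      fix r' assume r': "r' \<in> \<rat>" "r < r'" "r' < s"
      have "f s \<in> {f r' - B..}"
      proof (rule right_limit_mem_closed[OF rc, of s "min T (r + d)"])
        fix s' assume s': "s' \<in> \<rat>" "s < s'" "s' < min T (r + d)"
        have "ennreal (f r' - f s') \<le> drawdown f d T"
          unfolding drawdown_def using r' s' rs by (intro SUP_upper2[of "(r', s')"]) auto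
        with real show "f s' \<in> {f r' - B..}" by (auto simp: ennreal_le_iff)
      qed (use rs in auto)
      then show "f r' \<in> {..f s + B}" by auto
    qed (use rs less in auto)
    then show ?thesis using real by (auto intro!: ennreal_leI)
  qed simp
qed simp

text \<open>Near each \<open>t\<close> the path is within \<open>e / 2\<close> of its left limit on
  one side and of \<open>f t\<close> on the other, and the jump in between goes up. So no decrease
  inside the neighbourhood exceeds \<open>e\<close>, however large a rise may be. A Lebesgue number
  of the resulting cover of \<open>{0..T}\<close> serves as \<open>d0\<close>.\<close>

lemma drawdown_vanishes:
  assumes f: "upward_cadlag f" and e: "0 < e"
  shows "\<exists>d0>0. \<forall>d<d0. drawdown f d T \<le> ennreal e"
proof -
  have "\<exists>d>0. \<forall>r s. 0 \<le> r \<longrightarrow> r \<le> s \<longrightarrow> t - d < r \<longrightarrow> s < t + d \<longrightarrow> f r - f s \<le> e" if t: "0 \<le> t" for t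
  proof -
    obtain l d where d: "0 < d" "\<And>s. t \<le> s \<Longrightarrow> s < t + d \<Longrightarrow> \<bar>f s - f t\<bar> < e/2"
      "\<And>s. 0 \<le> s \<Longrightarrow> t - d < s \<Longrightarrow> s < t \<Longrightarrow> \<bar>f s - l\<bar> < e/2" "0 < t \<Longrightarrow> (f \<longlongrightarrow> l) (at_left t)"
      using cadlag_local[OF upward_cadlagD(2,3)[OF f] t half_gt_zero[OF e]] by metis
    have "f r - f s \<le> e" if rs: "0 \<le> r" "r \<le> s" "t - d < r" "s < t + d" for r s
    proof -
      consider "t \<le> r" | "r < t" "t \<le> s" | "s < t" using rs by linarith
      then show ?thesis
      proof cases
        case 1 then show ?thesis using d(2)[of r] d(2)[of s] rs by (auto simp: abs_if split: if_splits)
      next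
        case 2
        have "l \<le> f t" using 2 rs upward_cadlagD(4)[OF f] d(4) by auto
        then show ?thesis using d(3)[of r] d(2)[of s] rs 2 by (auto simp: abs_if split: if_splits)
      next
        case 3 then show ?thesis using d(3)[of r] d(3)[of s] rs by (auto simp: abs_if split: if_splits)
      qed
    qed
    with d(1) show ?thesis by blast
  qed
  then obtain d where d: "\<And>t. 0 \<le> t \<Longrightarrow> 0 < d t"
    "\<And>t r s. 0 \<le> t \<Longrightarrow> 0 \<le> r \<Longrightarrow> r \<le> s \<Longrightarrow> t - d t < r \<Longrightarrow> s < t + d t \<Longrightarrow> f r - f s \<le> e"
    by metis
  have cov: "{0..T} \<subseteq> \<Union>((\<lambda>t. {t - d t<..<t + d t}) ` {0..T})" using d(1) by force
  obtain d0 where d0: "0 < d0" "\<And>x. x \<in> {0..T} \<Longrightarrow> \<exists>G\<in>(\<lambda>t. {t - d t<..<t + d t}) ` {0..T}. ball x d0 \<subseteq> G"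
    using Heine_Borel_lemma[OF compact_Icc cov] by (metis (no_types, lifting) imageE open_greaterThanLessThan)
  have "drawdown f d' T \<le> ennreal e" if d': "d' < d0" for d'
    unfolding drawdown_def
  proof (intro SUP_least, clarsimp)
    fix r s assume rs: "0 \<le> r" "r \<le> s" "s \<le> T" "s - r \<le> d'"
    obtain t where t: "t \<in> {0..T}" "ball r d0 \<subseteq> {t - d t<..<t + d t}" using d0(2)[of r] rs by auto
    have "r \<in> ball r d0" "s \<in> ball r d0" using rs d' d0(1) by (auto simp: dist_real_def)
    then have "r \<in> {t - d t<..<t + d t}" "s \<in> {t - d t<..<t + d t}" using t(2) by blast+
    then show "ennreal (f r - f s) \<le> ennreal e" using d(2)[of t r s] t rs by (auto intro!: ennreal_leI)
  qed
  with d0(1) show ?thesis by blast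
qed

subsection \<open>Payments on a grid\<close>

lemma le_nat_floor_divide_iff:
  assumes "0 < d" "0 \<le> t"
  shows "j \<le> nat \<lfloor>t / d\<rfloor> \<longleftrightarrow> real j * d \<le> t"
  using assms by (simp add: le_nat_iff le_floor_iff field_simps)

lemma nat_floor_divide_eq:
  assumes "0 < d" "real k * d \<le> t" "t < (real k + 1) * d"
  shows "nat \<lfloor>t / d\<rfloor> = k"
proof -
  have "\<lfloor>t / d\<rfloor> = int k" using assms by (intro floor_unique) (auto simp: field_simps)
  then show ?thesis by simp
qed

text \<open>The running maximum makes the function nondecreasing whatever the grid values
  \<open>u\<close> are. Index 0 is always included, so the maximum is over a nonempty set; negative
  times get the value \<open>u 0\<close>.\<close>

definition step_max :: "real \<Rightarrow> (nat \<Rightarrow> real) \<Rightarrow> real \<Rightarrow> real" where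
  "step_max d u t = Max (u ` {..nat \<lfloor>t / d\<rfloor>})"

lemma step_max_upper:
  assumes "0 < d" "0 \<le> t" "real j * d \<le> t"
  shows "u j \<le> step_max d u t"
  unfolding step_max_def using le_nat_floor_divide_iff[of d t j] assms by (intro Max_ge) auto

lemma step_max_least:
  assumes "0 < d" "0 \<le> t" "\<And>j. real j * d \<le> t \<Longrightarrow> u j \<le> b"
  shows "step_max d u t \<le> b"
  unfolding step_max_def using le_nat_floor_divide_iff[of d t] assms by (auto simp: Max_le_iff)

lemma step_max_mono: "0 < d \<Longrightarrow> mono (step_max d u)"
  unfolding step_max_def
  by (intro monoI Max_mono image_mono) (auto intro!: nat_mono floor_mono divide_right_mono)

lemma step_max_cong: "nat \<lfloor>s / d\<rfloor> = nat \<lfloor>t / d\<rfloor> \<Longrightarrow> step_max d u s = step_max d u t"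
  by (simp add: step_max_def)

lemma step_max_eq_grid:
  assumes "0 < d" "real k * d \<le> t" "t < (real k + 1) * d"
  shows "step_max d u t = step_max d u (real k * d)"
  using nat_floor_divide_eq[OF assms] assms(1) by (intro step_max_cong) simp

lemma step_max_cell:
  assumes "0 < d" "0 \<le> t"
  obtains k :: nat where "real k * d \<le> t" "t < (real k + 1) * d"
proof (rule that[of "nat \<lfloor>t / d\<rfloor>"])
  show "real (nat \<lfloor>t / d\<rfloor>) * d \<le> t" using le_nat_floor_divide_iff[OF assms, of "nat \<lfloor>t / d\<rfloor>"] by simp
  show "t < (real (nat \<lfloor>t / d\<rfloor>) + 1) * d"
    using le_nat_floor_divide_iff[OF assms, of "Suc (nat \<lfloor>t / d\<rfloor>)"] by (simp add: add.commute)
qed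

lemma step_max_right_continuous:
  assumes "0 < d" "0 \<le> t"
  shows "continuous (at_right t) (step_max d u)"
proof -
  obtain k :: nat where k: "real k * d \<le> t" "t < (real k + 1) * d" using step_max_cell[OF assms] .
  have "eventually (\<lambda>s. step_max d u s = step_max d u t) (at_right t)"
    unfolding eventually_at_right_field
  proof (intro exI[of _ "(real k + 1) * d"] conjI allI impI)
    fix s assume s: "t < s" "s < (real k + 1) * d"
    have "nat \<lfloor>s / d\<rfloor> = nat \<lfloor>t / d\<rfloor>"
      using nat_floor_divide_eq[OF assms(1), of k] k s by simp
    then show "step_max d u s = step_max d u t" by (rule step_max_cong)
  qed (rule k)
  then show ?thesis by (simp add: continuous_within tendsto_eventually)
qed

lemma step_max_left_tendsto:
  assumes "0 < d" "real k * d < t" "t \<le> (real k + 1) * d"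
  shows "(step_max d u \<longlongrightarrow> step_max d u (real k * d)) (at_left t)"
proof -
  have "eventually (\<lambda>s. step_max d u s = step_max d u (real k * d)) (at_left t)"
    unfolding eventually_at_left_field
  proof (intro exI[of _ "real k * d"] conjI allI impI)
    fix s assume s: "real k * d < s" "s < t"
    then show "step_max d u s = step_max d u (real k * d)"
      using assms by (intro step_max_eq_grid) auto
  qed (rule assms)
  then show ?thesis by (rule tendsto_eventually)
qed

lemma step_max_jump:
  assumes "0 < d"
  shows "jump 0 (step_max d u) 0 = u 0"
    and "jump 0 (step_max d u) (real (Suc k) * d) = step_max d u (real (Suc k) * d) - step_max d u (real k * d)"
    and "0 \<le> t \<Longrightarrow> t \<notin> range (\<lambda>k. real k * d) \<Longrightarrow> jump 0 (step_max d u) t = 0"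
proof -
  show "jump 0 (step_max d u) 0 = u 0" by (simp add: jump_def left_value_def step_max_def)
  show "jump 0 (step_max d u) (real (Suc k) * d) = step_max d u (real (Suc k) * d) - step_max d u (real k * d)"
    unfolding jump_def
    by (subst left_value_eq[OF _ step_max_left_tendsto[OF assms, of k]]) (use assms in \<open>auto simp: algebra_simps add_pos_nonneg\<close>)
  assume t: "0 \<le> t" "t \<notin> range (\<lambda>k. real k * d)"
  obtain k :: nat where k: "real k * d \<le> t" "t < (real k + 1) * d" using step_max_cell[OF assms t(1)] .
  have "real k * d \<noteq> t" using t(2) by blast
  with k have k': "real k * d < t" by simp
  have "0 < t" using k' by (rule le_less_trans[rotated]) (use assms in simp)
  then show "jump 0 (step_max d u) t = 0"
    unfolding jump_def
    using left_value_eq[OF _ step_max_left_tendsto[OF assms k'], of 0 u] k step_max_eq_grid[OF assms k, of u] by simp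
qed

text \<open>Only grid times carry jumps, finitely many of them up to \<open>t\<close>, and these
  telescope. The jump at 0 contributes \<open>u 0\<close> because the left value there is 0 by
  convention.\<close>

lemma step_max_pure_jump:
  assumes d: "0 < d" and t: "0 \<le> t"
  shows "(jump 0 (step_max d u) has_sum step_max d u t) {0..t}"
proof -
  obtain n :: nat where n: "real n * d \<le> t" "t < (real n + 1) * d" using step_max_cell[OF d t] .
  let ?g = "\<lambda>k. real k * d"
  have sum: "(\<Sum>k\<le>m. jump 0 (step_max d u) (?g k)) = step_max d u (?g m)" for m
  proof (induction m)
    case 0
    have "step_max d u 0 = u 0" by (simp add: step_max_def)
    then show ?case by (simp add: step_max_jump(1)[OF d])
  next
    case (Suc m)
    then show ?case by (simp only: sum.atMost_Suc step_max_jump(2)[OF d])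
  qed
  have inj: "inj_on ?g A" for A using d by (auto simp: inj_on_def)
  have "(jump 0 (step_max d u) has_sum (\<Sum>s\<in>?g ` {..n}. jump 0 (step_max d u) s)) {0..t}"
  proof (rule has_sum_finite_neutralI)
    show "?g ` {..n} \<subseteq> {0..t}"
    proof (rule image_subsetI)
      fix k assume "k \<in> {..n}"
      then have "?g k \<le> ?g n" using d by (intro mult_right_mono) auto
      with n have "?g k \<le> t" by linarith
      then show "?g k \<in> {0..t}" using d by simp
    qed
  next
    fix s assume s: "s \<in> {0..t} - ?g ` {..n}"
    have "s \<notin> range ?g"
    proof
      assume "s \<in> range ?g"
      then obtain k :: nat where k: "s = real k * d" by blast
      have "real k * d < (real n + 1) * d" using n(2) s k by simp
      then have "k \<le> n" using d by (simp add: mult_less_cancel_right)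
      then show False using s k by blast
    qed
    then show "jump 0 (step_max d u) s = 0" using s by (intro step_max_jump[OF d]) auto
  qed auto
  also have "(\<Sum>s\<in>?g ` {..n}. jump 0 (step_max d u) s) = step_max d u t"
    by (subst sum.reindex[OF inj]) (simp add: sum step_max_eq_grid[OF d n])
  finally show ?thesis .
qed

section \<open>Ruin times and the jump constraint\<close>

lemma ruin_time_nonneg: "0 \<le> ruin_time X x L \<omega>"
  unfolding ruin_time_def by (intro INF_greatest) auto

lemma ruin_time_upper: "0 < t \<Longrightarrow> surplus X x L \<omega> t < 0 \<Longrightarrow> ruin_time X x L \<omega> \<le> ereal t"
  unfolding ruin_time_def by (intro INF_lower) auto

lemma ruin_time_lessD:
  assumes "ruin_time X x L \<omega> < ereal t"
  obtains r where "0 < r" "r < t" "ruin_time X x L \<omega> \<le> ereal r" "surplus X x L \<omega> r < 0"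
proof -
  from assms obtain r where "0 < r" "surplus X x L \<omega> r < 0" "r < t"
    unfolding ruin_time_def INF_less_iff by auto
  then show thesis by (intro that[of r] ruin_time_upper)
qed

lemma surplus_nonneg:
  assumes "0 < t" "ereal t < ruin_time X x L \<omega>"
  shows "0 \<le> surplus X x L \<omega> t"
  using ruin_time_upper[of t X x L \<omega>] assms leD not_le_imp_less by metis

lemma mono_on_left_limit:
  fixes l :: "real \<Rightarrow> real"
  assumes l: "mono_on {0..} l" and t: "0 < t"
  shows "\<exists>c. (l \<longlongrightarrow> c) (at_left t)"
proof
  let ?c = "Sup (l ` {0..<t})"
  have bdd: "bdd_above (l ` {0..<t})"
    using mono_onD[OF l] t by (intro bdd_aboveI[of _ "l t"]) auto
  have ne: "l ` {0..<t} \<noteq> {}" using t by auto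
  show "(l \<longlongrightarrow> ?c) (at_left t)"
  proof (rule order_tendstoI)
    fix y assume "y < ?c"
    then obtain s where s: "0 \<le> s" "s < t" "y < l s"
      using less_cSup_iff[OF ne bdd] by auto
    then have "y < l r" if "s < r" "r < t" for r using mono_onD[OF l, of s r] that by auto
    then show "eventually (\<lambda>r. y < l r) (at_left t)"
      unfolding eventually_at_left_field using s by blast
  next
    fix y assume y: "?c < y"
    have "l r < y" if "0 < r" "r < t" for r
    proof -
      have "l r \<le> ?c" using that by (intro cSup_upper[OF _ bdd]) auto
      then show ?thesis using y by simp
    qed
    then show "eventually (\<lambda>r. l r < y) (at_left t)"
      unfolding eventually_at_left_field using t by blast
  qed
qed

text \<open>The left limits of \<open>X\<close> and \<open>L\<close> exist and cancel, so the
  constraint on the jump only says that the surplus after the payment is nonnegative. At time 0 the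
  conventions for left values lead to the same inequality.\<close>

lemma jump_constraint_iff:
  assumes f: "upward_cadlag (\<lambda>t. X t \<omega>)" and l: "mono_on {0..} (\<lambda>t. L t \<omega>)" and t: "0 \<le> t"
  shows "jump 0 (\<lambda>s. L s \<omega>) t \<le> left_value x (surplus X x L \<omega>) t + jump 0 (\<lambda>s. X s \<omega>) t
    \<longleftrightarrow> L t \<omega> \<le> x + X t \<omega>"
proof (cases "t = 0")
  case True
  then show ?thesis by (simp add: jump_def left_value_def)
next
  case False
  with t have t: "0 < t" by simp
  obtain c where c: "((\<lambda>s. L s \<omega>) \<longlongrightarrow> c) (at_left t)" using mono_on_left_limit[OF l t] by blast
  obtain b where b: "((\<lambda>s. X s \<omega>) \<longlongrightarrow> b) (at_left t)" using upward_cadlagD(3)[OF f t] by blast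
  have "((\<lambda>s. x + X s \<omega> - L s \<omega>) \<longlongrightarrow> x + b - c) (at_left t)" by (intro tendsto_intros b c)
  moreover have "surplus X x L \<omega> = (\<lambda>s. x + X s \<omega> - L s \<omega>)" by (simp add: surplus_def fun_eq_iff)
  ultimately have u: "(surplus X x L \<omega> \<longlongrightarrow> x + b - c) (at_left t)" by simp
  show ?thesis
    unfolding jump_def left_value_eq[OF t c] left_value_eq[OF t b] left_value_eq[OF t u] by auto
qed

text \<open>The term \<open>x + X\<close> caps a payment at the surplus available, and the maximum
  inside \<open>step_max\<close> never takes back what has been paid. The outer \<open>max 0\<close>
  makes the process nonnegative for every \<omega>, as \<open>dividend_process\<close> demands,
  while \<open>X 0 = 0\<close> holds only almost surely.\<close>

definition lumped ::
    "real \<Rightarrow> real \<Rightarrow> real \<Rightarrow> (real \<Rightarrow> 'a \<Rightarrow> real) \<Rightarrow> (real \<Rightarrow> 'a \<Rightarrow> real) \<Rightarrow> real \<Rightarrow> 'a \<Rightarrow> real" where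
  "lumped d a x X L t \<omega> =
     step_max d (\<lambda>j. max 0 (min (max (L (real j * d) \<omega>) (x - a)) (x + X (real j * d) \<omega>))) t"

lemma lumped_le_target:
  assumes l: "mono_on {0..} (\<lambda>t. L t \<omega>)" and "0 \<le> L 0 \<omega>" "0 < d" "0 \<le> t"
  shows "lumped d a x X L t \<omega> \<le> max (L t \<omega>) (x - a)"
  unfolding lumped_def
proof (rule step_max_least)
  fix j assume j: "real j * d \<le> t"
  have "L (real j * d) \<omega> \<le> L t \<omega>" "0 \<le> L t \<omega>"
    using mono_onD[OF l, of "real j * d" t] mono_onD[OF l, of 0 t] j assms by auto
  then show "max 0 (min (max (L (real j * d) \<omega>) (x - a)) (x + X (real j * d) \<omega>)) \<le> max (L t \<omega>) (x - a)" by auto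
qed (use assms in auto)

lemma lumped_mono_on: "0 < d \<Longrightarrow> mono_on A (\<lambda>t. lumped d a x X L t \<omega>)"
  unfolding lumped_def using step_max_mono by (auto simp: mono_def mono_on_def)

lemma lumped_nonneg: "0 < d \<Longrightarrow> 0 \<le> t \<Longrightarrow> 0 \<le> lumped d a x X L t \<omega>"
  unfolding lumped_def by (rule order_trans[OF _ step_max_upper[of d t 0]]) auto

lemma lumped_ge_initial:
  assumes "0 < d" "0 \<le> t" "X 0 \<omega> = 0" "0 \<le> a" "0 \<le> x"
  shows "max 0 (x - a) \<le> lumped d a x X L t \<omega>"
  unfolding lumped_def by (rule order_trans[OF _ step_max_upper[of d t 0]]) (use assms in auto)

text \<open>What was paid before \<open>t\<close> stays covered by \<open>x + X\<close> as long as
  there is no ruin, hence up to the left limit at \<open>t\<close>, and \<open>X\<close> cannot jump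
  down from there. A payment at \<open>t\<close> itself is capped by construction. The argument
  covers the ruin time too.\<close>

lemma lumped_le_surplus:
  assumes f: "upward_cadlag (\<lambda>t. X t \<omega>)" and d: "0 < d" and x: "0 \<le> x" and t: "0 \<le> t"
    and ruin: "ereal t \<le> ruin_time X x (lumped d a x X L) \<omega>"
  shows "lumped d a x X L t \<omega> \<le> x + X t \<omega>"
proof (cases "t = 0")
  case True
  then show ?thesis using upward_cadlagD(1)[OF f] x by (auto simp: lumped_def step_max_def)
next
  case False
  with t have t': "0 < t" by simp
  let ?u = "\<lambda>j. max 0 (min (max (L (real j * d) \<omega>) (x - a)) (x + X (real j * d) \<omega>))"
  have left: "c \<le> x + X t \<omega>" if s0: "0 \<le> s0" "s0 < t" and c: "\<And>s. s0 < s \<Longrightarrow> s < t \<Longrightarrow> c \<le> lumped d a x X L s \<omega>" for c s0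
  proof -
    obtain b where b: "((\<lambda>s. X s \<omega>) \<longlongrightarrow> b) (at_left t)" using upward_cadlagD(3)[OF f t'] by blast
    have "c \<le> x + X s \<omega>" if s: "s0 < s" "s < t" for s
    proof -
      have "ereal s < ruin_time X x (lumped d a x X L) \<omega>" using s ruin by (auto intro: less_le_trans[rotated])
      then show ?thesis using surplus_nonneg[of s X x "lumped d a x X L" \<omega>] c[OF s] s s0 by (simp add: surplus_def)
    qed
    then have "eventually (\<lambda>s. c \<le> x + X s \<omega>) (at_left t)"
      unfolding eventually_at_left_field using s0 by blast
    then have "c \<le> x + b" by (intro tendsto_lowerbound[OF tendsto_add[OF tendsto_const b]]) auto
    then show ?thesis using upward_cadlagD(4)[OF f t' b] by simp
  qed
  \<comment> \<open>The instance for level 0; it is what puts the outer \<open>max 0\<close> of a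
    payment made at \<open>t\<close> itself below \<open>x + X t\<close>.\<close>
  have nn: "0 \<le> x + X t \<omega>" using t' by (intro left[of 0] lumped_nonneg[OF d]) simp_all
  show ?thesis
    unfolding lumped_def
  proof (rule step_max_least[OF d t])
    fix j assume j: "real j * d \<le> t"
    show "?u j \<le> x + X t \<omega>"
    proof (cases "real j * d = t")
      case True
      with nn show ?thesis by auto
    next
      case False
      with j have j: "real j * d < t" by simp
      then show ?thesis
      proof (rule left[rotated])
        fix s assume "real j * d < s" "s < t"
        moreover have "0 \<le> real j * d" using d by simp
        ultimately show "?u j \<le> lumped d a x X L s \<omega>"
          unfolding lumped_def by (intro step_max_upper[OF d, of s j ?u]) linarith+
      qed (use d in auto)
    qed
  qed
qed

text \<open>For \<open>T \<ge> 0\<close> the minimum is a real number even if \<open>T\<close> is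
  infinite, so it can serve as a time argument of paths.\<close>

definition stop :: "ereal \<Rightarrow> real \<Rightarrow> real" where
  "stop T t = real_of_ereal (min T (ereal t))"

lemma ereal_stop: "0 \<le> T \<Longrightarrow> 0 \<le> t \<Longrightarrow> ereal (stop T t) = min T (ereal t)"
  unfolding stop_def by (cases T) (auto simp: min_def)

lemma stop_bounds:
  assumes "0 \<le> T" "0 \<le> t"
  shows "0 \<le> stop T t" "stop T t \<le> t" "ereal (stop T t) \<le> T"
  using assms unfolding stop_def by (cases T; auto simp: min_def)+

text \<open>Each alternative exhibits a time \<open>r\<close> that accounts for the shortfall: the
  grid time at which the surplus capped the payment, or a time of negative surplus right after the
  ruin of the new strategy. If there is no shortfall, \<open>r = s\<close> serves.\<close>

lemma lumped_comparison:
  fixes X :: "real \<Rightarrow> 'a \<Rightarrow> real"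
  assumes f: "upward_cadlag (\<lambda>t. X t \<omega>)"
    and l: "mono_on {0..} (\<lambda>t. L t \<omega>)" "0 \<le> L 0 \<omega>"
    and adm: "\<And>t. 0 \<le> t \<Longrightarrow> ereal t \<le> ruin_time X x L \<omega> \<Longrightarrow> L t \<omega> \<le> x + X t \<omega>"
    and d: "0 < d" and a: "0 \<le> a" and x: "0 \<le> x" and t: "0 \<le> t"
  defines "L' \<equiv> lumped d a x X L"
  defines "s \<equiv> stop (ruin_time X x L \<omega>) t"
  defines "s' \<equiv> stop (ruin_time X x L' \<omega>) (t + d)"
  shows "(\<exists>r. s \<le> r \<and> r < s + d \<and> L s \<omega> \<le> L' s' \<omega> + (X s \<omega> - X r \<omega>)) \<or>
    (\<exists>r. 0 \<le> r \<and> r < t + d \<and> X r \<omega> < - a \<and> L s \<omega> \<le> L' s' \<omega> + (a + X s \<omega>))"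
proof -
  \<comment> \<open>The first grid time from \<open>s\<close> on, where the new strategy tries to
    catch up; it comes less than \<open>d\<close> later.\<close>
  define g where "g = real (nat \<lceil>s / d\<rceil>) * d"
  have s: "0 \<le> s" "s \<le> t" "ereal s \<le> ruin_time X x L \<omega>"
    unfolding s_def by (rule stop_bounds[OF ruin_time_nonneg t])+
  have Ls: "L s \<omega> \<le> x + X s \<omega>" using adm s by blast
  have ceil: "real (nat \<lceil>s / d\<rceil>) = of_int \<lceil>s / d\<rceil>" using s d by simp
  have gs: "s \<le> g" "g < s + d" unfolding g_def ceil
  proof -
    show "s \<le> of_int \<lceil>s / d\<rceil> * d" using le_of_int_ceiling[of "s / d"] pos_divide_le_eq[OF d] by blast
    show "of_int \<lceil>s / d\<rceil> * d < s + d" using ceiling_correct[of "s / d"] d by (simp add: field_simps)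
  qed
  have s'0: "0 \<le> s'" unfolding s'_def using stop_bounds[OF ruin_time_nonneg, of "t + d"] t d by auto
  have L'0: "max 0 (x - a) \<le> L' s' \<omega>"
    unfolding L'_def by (rule lumped_ge_initial[where X=X and \<omega>=\<omega>, OF d s'0 upward_cadlagD(1)[OF f] a x])
  show ?thesis
  proof (cases "ereal g \<le> ruin_time X x L' \<omega>")
    case True
    have "ereal g \<le> ereal s'" unfolding s'_def
      using True gs s t d by (subst ereal_stop[OF ruin_time_nonneg]) auto
    then have "g \<le> s'" by simp
    then have "max 0 (min (max (L g \<omega>) (x - a)) (x + X g \<omega>)) \<le> L' s' \<omega>"
      unfolding L'_def lumped_def g_def using s'0 d by (intro step_max_upper) auto
    moreover have "L s \<omega> \<le> L g \<omega>" using gs s mono_onD[OF l(1), of s g] by auto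
    \<comment> \<open>Either the target was met at \<open>g\<close>, or the whole surplus was paid
      out there; in the second case admissibility of \<open>L\<close> bounds \<open>L s\<close> by
      \<open>x + X s\<close>.\<close>
    ultimately have "L s \<omega> \<le> L' s' \<omega> \<or> x + X g \<omega> \<le> L' s' \<omega>" by linarith
    then show ?thesis
    proof
      assume "L s \<omega> \<le> L' s' \<omega>"
      then show ?thesis using d by (intro disjI1 exI[of _ s]) auto
    next
      assume "x + X g \<omega> \<le> L' s' \<omega>"
      then show ?thesis using gs Ls by (intro disjI1 exI[of _ g]) auto
    qed
  next
    case False
    then have ruin: "ruin_time X x L' \<omega> < ereal g" by simp
    moreover have "ereal g \<le> ereal (t + d)" using gs s by simp
    ultimately have "ruin_time X x L' \<omega> \<le> ereal (t + d)" by (metis less_imp_le order_trans)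
    then have s'e: "ereal s' = ruin_time X x L' \<omega>" unfolding s'_def
      using t d by (subst ereal_stop[OF ruin_time_nonneg]) (auto simp: min_absorb1)
    with ruin have s'g: "s' < g" by (metis ereal_less_eq(3) linorder_not_le)
    \<comment> \<open>The new strategy is ruined before \<open>g\<close>. As ruin is an infimum,
      there is a time \<open>r\<close> of negative surplus in the same grid cell as
      \<open>s'\<close>, and nothing is paid between \<open>s'\<close> and \<open>r\<close>.\<close>
    obtain k :: nat where k: "real k * d \<le> s'" "s' < (real k + 1) * d" using step_max_cell[OF d s'0] .
    have "real k * d < real (nat \<lceil>s / d\<rceil>) * d" using k s'g unfolding g_def by linarith
    then have "real k + 1 \<le> real (nat \<lceil>s / d\<rceil>)" using d by (simp add: mult_less_cancel_right)
    then have kg: "(real k + 1) * d \<le> g" unfolding g_def using d by (intro mult_right_mono) auto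
    obtain r where r: "0 < r" "r < (real k + 1) * d" "ruin_time X x L' \<omega> \<le> ereal r" "surplus X x L' \<omega> r < 0"
      using ruin_time_lessD[of X x L' \<omega> "(real k + 1) * d"] k s'e[symmetric] by auto
    have s'r: "s' \<le> r" using r(3) s'e by (metis ereal_less_eq(3))
    have L'r: "L' r \<omega> = L' s' \<omega>" unfolding L'_def lumped_def
      using k r(2) s'r by (intro step_max_cong) (metis nat_floor_divide_eq[OF d] order_trans)
    have neg: "x + X r \<omega> < L' r \<omega>" using r(4) by (simp add: surplus_def)
    show ?thesis
    proof (cases "X r \<omega> < - a")
      case True
      \<comment> \<open>Here \<open>L s \<le> x + X s = (x - a) + (a + X s)\<close>, and the new
        strategy has paid at least \<open>x - a\<close> from time 0 on.\<close>
      then show ?thesis using r kg gs s Ls L'0 by (intro disjI2 exI[of _ r]) auto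
    next
      case False
      \<comment> \<open>With \<open>X r \<ge> - a\<close> the negative surplus cannot be due to the
        target \<open>x - a\<close>. So \<open>L\<close> has overdrawn at \<open>r\<close> as well
        and is ruined by then, whence \<open>s \<le> r\<close>.\<close>
      have "L' r \<omega> \<le> max (L r \<omega>) (x - a)" unfolding L'_def using r by (intro lumped_le_target l d) auto
      with neg False have "surplus X x L \<omega> r < 0" by (auto simp: surplus_def)
      then have "ruin_time X x L \<omega> \<le> ereal r" using r by (intro ruin_time_upper)
      then have "s \<le> r" using s(3) by (metis ereal_less_eq(3) order_trans)
      then show ?thesis using r kg gs Ls neg L'r by (intro disjI1 exI[of _ r]) auto
    qed
  qed
qed

subsection \<open>Pathwise comparison of discounted dividends\<close>

text \<open>The distribution function of the payments until ruin; the value 0 at negative times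
  turns a payment at time 0 into an atom.\<close>

definition paid :: "ereal \<Rightarrow> (real \<Rightarrow> real) \<Rightarrow> real \<Rightarrow> real" where
  "paid T l s = (if s < 0 then 0 else l (stop T s))"

lemma stop_mono:
  assumes "0 \<le> T" "s \<le> t"
  shows "stop T s \<le> stop T t"
  using assms unfolding stop_def by (cases T) (auto simp: min_def)

lemma paid_mono:
  assumes l: "mono_on {0..} l" "0 \<le> l 0" and T: "0 \<le> T"
  shows "mono (paid T l)"
proof (rule monoI)
  fix s t :: real assume st: "s \<le> t"
  have "l 0 \<le> l (stop T t)" if "0 \<le> t" using mono_onD[OF l(1), of 0 "stop T t"] stop_bounds[OF T that] by auto
  moreover have "l (stop T s) \<le> l (stop T t)" if "0 \<le> s"
    using mono_onD[OF l(1), of "stop T s" "stop T t"] stop_bounds[OF T that] stop_mono[OF T st] by auto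
  ultimately show "paid T l s \<le> paid T l t" using st l(2) by (auto simp: paid_def)
qed

text \<open>The half-open intervals from \<open>- 1 / (n + 1)\<close> to \<open>b\<close> all have
  mass \<open>F b\<close> and shrink to the closed interval, so an atom at 0 is included.\<close>

lemma emeasure_interval_measure_from_zero:
  assumes mono: "mono F" and rc: "\<And>t. continuous (at_right t) F" and zero: "\<And>t. t < 0 \<Longrightarrow> F t = 0" and b: "0 \<le> b"
  shows "emeasure (interval_measure F) {0..b} = ennreal (F b)"
proof -
  let ?A = "\<lambda>n::nat. {- (1 / real (Suc n))<..b}"
  have "(\<Inter>n. ?A n) = {0..b}"
  proof (intro equalityI subsetI)
    fix y assume y: "y \<in> (\<Inter>n. ?A n)"
    have "0 \<le> y"
    proof (rule ccontr)
      assume "\<not> 0 \<le> y"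
      then obtain n where "inverse (real (Suc n)) < - y" using reals_Archimedean[of "- y"] by auto
      then show False using y by (auto simp: inverse_eq_divide dest!: spec[of _ n])
    qed
    then show "y \<in> {0..b}" using y by auto
  next
    fix y assume y: "y \<in> {0..b}"
    have "- (1 / real (Suc n)) < y" for n using y by (auto intro: less_le_trans[of _ 0])
    then show "y \<in> (\<Inter>n. ?A n)" using y by auto
  qed
  moreover have eq: "emeasure (interval_measure F) (?A n) = ennreal (F b)" for n
  proof -
    have "- (1 / real (Suc n)) < 0" by simp
    moreover from this have "- (1 / real (Suc n)) \<le> b" using b by linarith
    ultimately show ?thesis using zero b
      by (subst emeasure_interval_measure_Ioc) (auto simp: rc monoD[OF mono] simp del: of_nat_Suc)
  qed
  moreover have "(\<lambda>n. emeasure (interval_measure F) (?A n)) \<longlonglongrightarrow> emeasure (interval_measure F) (\<Inter>n. ?A n)"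
  proof (rule Lim_emeasure_decseq)
    show "decseq ?A"
    proof (intro decseq_SucI subsetI)
      fix n y assume "y \<in> ?A (Suc n)"
      moreover have "1 / real (Suc (Suc n)) \<le> 1 / real (Suc n)" by (intro divide_left_mono) auto
      ultimately show "y \<in> ?A n" unfolding greaterThanAtMost_iff by linarith
    qed
  qed (use eq in auto)
  ultimately show ?thesis by (simp add: LIMSEQ_const_iff)
qed

lemma nn_integral_exp_tail:
  assumes "0 < q"
  shows "(\<integral>\<^sup>+ s. ennreal (q * exp (- q * s)) * indicator {t..} s \<partial>lborel) = ennreal (exp (- q * t))"
proof -
  have lim: "((\<lambda>s. - exp (- q * s)) \<longlongrightarrow> 0) at_top"
  proof -
    have "filterlim (\<lambda>s. - q * s) at_bot at_top"
      using assms by (intro filterlim_tendsto_neg_mult_at_bot[OF tendsto_const _ filterlim_ident]) auto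
    then have "((\<lambda>s. exp (- q * s)) \<longlongrightarrow> 0) at_top" by (rule filterlim_compose[OF exp_at_bot])
    then show ?thesis using tendsto_minus by fastforce
  qed
  have "(\<integral>\<^sup>+ s. ennreal (q * exp (- q * s)) * indicator {t..} s \<partial>lborel) = 0 - (- exp (- q * t))"
    using assms by (intro nn_integral_FTC_atLeast[OF _ _ _ lim]) (auto intro!: derivative_eq_intros)
  then show ?thesis by simp
qed

text \<open>Tonelli, after the discount factor has been written as a tail integral. The inner
  integral is then the mass of the payment times up to \<open>s\<close> and up to ruin, a closed
  interval from 0 that contains the ruin time itself if this is at most \<open>s\<close>.\<close>

lemma discounted_dividends_eq:
  assumes q: "0 < q" and l: "mono_on {0..} (\<lambda>t. L t \<omega>)" "0 \<le> L 0 \<omega>"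
    and rc: "\<And>t. 0 \<le> t \<Longrightarrow> continuous (at_right t) (\<lambda>s. L s \<omega>)"
  shows "discounted_dividends X q x L \<omega> =
    (\<integral>\<^sup>+ s. ennreal (q * exp (- q * s)) * ennreal (paid (ruin_time X x L \<omega>) (\<lambda>t. L t \<omega>) s) \<partial>lborel)"
proof -
  let ?T = "ruin_time X x L \<omega>"
  define F where "F t = (if t < 0 then 0 else L t \<omega>)" for t
  define N where "N = interval_measure F"
  have mono: "mono F"
  proof (rule monoI)
    fix s t :: real assume "s \<le> t"
    then show "F s \<le> F t"
      using mono_onD[OF l(1), of s t] mono_onD[OF l(1), of 0 t] l(2) unfolding F_def by auto
  qed
  have Frc: "continuous (at_right t) F" for t
  proof (cases "t < 0")
    case True
    then have "eventually (\<lambda>s. F s = 0) (at_right t)"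
      unfolding eventually_at_right_field F_def by (intro exI[of _ 0]) auto
    then show ?thesis using True by (simp add: continuous_within F_def tendsto_eventually)
  next
    case False
    then have "eventually (\<lambda>s. L s \<omega> = F s) (at_right t)"
      unfolding eventually_at_right_field F_def by (intro exI[of _ "t + 1"]) auto
    moreover have "((\<lambda>s. L s \<omega>) \<longlongrightarrow> F t) (at_right t)"
      using rc[of t] False unfolding continuous_within F_def by simp
    ultimately show ?thesis unfolding continuous_within by (rule Lim_transform_eventually[rotated])
  qed
  interpret N: sigma_finite_measure N
    unfolding N_def by (intro sigma_finite_interval_measure Frc monoD[OF mono])
  interpret pair_sigma_finite N lborel ..
  have sN[measurable_cong]: "sets N = sets borel" by (simp add: N_def)
  define A where "A = {t. 0 \<le> t \<and> ereal t \<le> ?T}"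
  have Am[measurable]: "A \<in> sets borel" unfolding A_def by measurable
  have "discounted_dividends X q x L \<omega> =
      (\<integral>\<^sup>+ t. (\<integral>\<^sup>+ s. ennreal (q * exp (- q * s)) * indicator {t..} s \<partial>lborel) * indicator A t \<partial>N)"
    unfolding discounted_dividends_def nn_integral_exp_tail[OF q] N_def F_def A_def lifetime_def ..
  also have "\<dots> = (\<integral>\<^sup>+ t. (\<integral>\<^sup>+ s. ennreal (q * exp (- q * s)) * indicator {t..} s * indicator A t \<partial>lborel) \<partial>N)"
    by (simp add: nn_integral_multc)
  also have "\<dots> = (\<integral>\<^sup>+ s. (\<integral>\<^sup>+ t. ennreal (q * exp (- q * s)) * indicator {t..} s * indicator A t \<partial>N) \<partial>lborel)"
    by (rule Fubini'[symmetric]) (unfold split_beta' indicator_def atLeast_iff, measurable)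
  also have "\<dots> = (\<integral>\<^sup>+ s. ennreal (q * exp (- q * s)) * ennreal (paid ?T (\<lambda>t. L t \<omega>) s) \<partial>lborel)"
  proof (rule nn_integral_cong)
    fix s :: real
    have T0: "0 \<le> ?T" by (rule ruin_time_nonneg)
    have meas: "emeasure N (A \<inter> {..s}) = ennreal (paid ?T (\<lambda>t. L t \<omega>) s)"
    proof (cases "s < 0")
      case True
      then have "A \<inter> {..s} = {}" by (auto simp: A_def)
      then show ?thesis using True by (simp add: paid_def)
    next
      case False
      then have s: "0 \<le> s" by simp
      have "A \<inter> {..s} = {0..stop ?T s}"
      proof -
        have iff: "t \<le> stop ?T s \<longleftrightarrow> ereal t \<le> ?T \<and> t \<le> s" for t
        proof -
          have iff: "t \<le> stop ?T s \<longleftrightarrow> ereal t \<le> ereal (stop ?T s)" by simp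
          also have "\<dots> \<longleftrightarrow> ereal t \<le> ?T \<and> ereal t \<le> ereal s" unfolding ereal_stop[OF T0 s] by (rule min.bounded_iff)
          finally show ?thesis by simp
        qed
        show ?thesis unfolding A_def by (rule set_eqI) (simp add: iff)
      qed
      moreover have "emeasure N {0..stop ?T s} = ennreal (F (stop ?T s))"
        unfolding N_def using stop_bounds[OF T0 s]
        by (intro emeasure_interval_measure_from_zero[OF mono Frc]) (simp_all add: F_def)
      moreover have "F (stop ?T s) = paid ?T (\<lambda>t. L t \<omega>) s"
        using stop_bounds(1)[OF T0 s] s by (simp add: F_def paid_def)
      ultimately show ?thesis by simp
    qed
    have "(\<integral>\<^sup>+ t. ennreal (q * exp (- q * s)) * indicator {t..} s * indicator A t \<partial>N)
        = (\<integral>\<^sup>+ t. ennreal (q * exp (- q * s)) * indicator (A \<inter> {..s}) t \<partial>N)"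
      by (intro nn_integral_cong) (auto simp: indicator_def)
    also have "\<dots> = ennreal (q * exp (- q * s)) * emeasure N (A \<inter> {..s})"
      by (rule nn_integral_cmult_indicator) (simp add: sN)
    also note meas
    finally show "(\<integral>\<^sup>+ t. ennreal (q * exp (- q * s)) * indicator {t..} s * indicator A t \<partial>N) =
      ennreal (q * exp (- q * s)) * ennreal (paid ?T (\<lambda>t. L t \<omega>) s)" .
  qed
  finally show ?thesis .
qed

lemma nat_floor_measurable[measurable]: "(\<lambda>s::real. nat \<lfloor>s\<rfloor>) \<in> borel \<rightarrow>\<^sub>M count_space UNIV"
  by measurable

lemma ennreal_le_suminf: "f n \<le> (\<Sum>n. f n)" for f :: "nat \<Rightarrow> ennreal"
  using sum_le_suminf[of f "{n}"] by simp

text \<open>On \<open>{n..<n + 1}\<close> the weight is at most its value at \<open>n\<close>. With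
  errors that depend on time only through \<open>n\<close>, a countable sum of random variables is
  left for the expectation.\<close>

lemma nn_integral_le_series:
  fixes h :: "nat \<Rightarrow> ennreal"
  assumes q: "0 < q"
  shows "(\<integral>\<^sup>+ s. ennreal (q * exp (- q * s)) * indicator {0..} s * h (nat \<lfloor>s\<rfloor>) \<partial>lborel)
    \<le> (\<Sum>n. ennreal (q * exp (- q * real n)) * h n)"
proof -
  have "(\<integral>\<^sup>+ s. ennreal (q * exp (- q * s)) * indicator {0..} s * h (nat \<lfloor>s\<rfloor>) \<partial>lborel)
      \<le> (\<integral>\<^sup>+ s. (\<Sum>n. ennreal (q * exp (- q * real n)) * h n * indicator {real n..<real n + 1} s) \<partial>lborel)"
  proof (rule nn_integral_mono)
    fix s :: real
    show "ennreal (q * exp (- q * s)) * indicator {0..} s * h (nat \<lfloor>s\<rfloor>)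
      \<le> (\<Sum>n. ennreal (q * exp (- q * real n)) * h n * indicator {real n..<real n + 1} s)"
    proof (cases "0 \<le> s")
      case True
      define n where "n = nat \<lfloor>s\<rfloor>"
      have n: "real n \<le> s" "s < real n + 1" using True unfolding n_def by linarith+
      have "ennreal (q * exp (- q * s)) * h n \<le> ennreal (q * exp (- q * real n)) * h n * indicator {real n..<real n + 1} s"
        using n q by (auto intro!: mult_right_mono ennreal_leI)
      also have "\<dots> \<le> (\<Sum>n. ennreal (q * exp (- q * real n)) * h n * indicator {real n..<real n + 1} s)"
        by (rule ennreal_le_suminf)
      finally show ?thesis using True by (simp add: n_def)
    qed simp
  qed
  also have "\<dots> = (\<Sum>n. \<integral>\<^sup>+ s. ennreal (q * exp (- q * real n)) * h n * indicator {real n..<real n + 1} s \<partial>lborel)"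
    by (rule nn_integral_suminf) measurable
  also have "\<dots> = (\<Sum>n. ennreal (q * exp (- q * real n)) * h n)"
    by (subst nn_integral_cmult_indicator) auto
  finally show ?thesis .
qed

lemma ennreal_add_le: "0 \<le> a \<Longrightarrow> ennreal (a + b) \<le> ennreal a + ennreal b"
  by (cases "0 \<le> b") (auto simp: ennreal_neg intro!: ennreal_leI)

text \<open>The constant \<open>b\<close>, which \<open>H\<close> has reached from time 0 on, does
  not suffer from the delay; only \<open>H - b\<close> is exposed to the factor
  \<open>exp (q * d)\<close>. With \<open>b = max 0 (x - a)\<close> the loss does not grow with
  \<open>x\<close>.\<close>

lemma discounted_integral_shift:
  fixes G H :: "real \<Rightarrow> real" and h k :: "nat \<Rightarrow> ennreal"
  assumes q: "0 < q" and d: "0 < d" and H: "mono H" "\<And>s. s < 0 \<Longrightarrow> H s = 0"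
    and G0: "\<And>s. s < 0 \<Longrightarrow> G s = 0" and b: "0 \<le> b" "\<And>s. 0 \<le> s \<Longrightarrow> b \<le> H s"
    and le: "\<And>s. 0 \<le> s \<Longrightarrow> ennreal (G s) \<le> ennreal (H (s + d)) + h (nat \<lfloor>s\<rfloor>)"
    and k: "\<And>s. 0 \<le> s \<Longrightarrow> ennreal (H s - b) \<le> k (nat \<lfloor>s\<rfloor>)"
  shows "(\<integral>\<^sup>+ s. ennreal (q * exp (- q * s)) * ennreal (G s) \<partial>lborel) \<le>
    (\<integral>\<^sup>+ s. ennreal (q * exp (- q * s)) * ennreal (H s) \<partial>lborel) +
    (\<Sum>n. ennreal (q * exp (- q * real n)) * (h n + ennreal (exp (q * d) - 1) * k n))"
proof -
  define w where "w s = ennreal (q * exp (- q * s)) * indicator {0..} s" for s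
  define K where "K s = ennreal (H s - b) * indicator {0..} s" for s
  have [measurable]: "H \<in> borel_measurable borel" by (rule borel_measurable_mono[OF H(1)])
  have [measurable]: "w \<in> borel_measurable borel" "K \<in> borel_measurable borel"
    unfolding w_def K_def by measurable
  have split: "ennreal (H s) = ennreal b + K s" if "0 \<le> s" for s
    using b that by (simp add: K_def ennreal_plus[symmetric] del: ennreal_plus)
  have "(\<integral>\<^sup>+ s. ennreal (q * exp (- q * s)) * ennreal (G s) \<partial>lborel)
      \<le> (\<integral>\<^sup>+ s. w s * ennreal b + w s * K (s + d) + w s * h (nat \<lfloor>s\<rfloor>) \<partial>lborel)"
  proof (rule nn_integral_mono)
    fix s :: real
    show "ennreal (q * exp (- q * s)) * ennreal (G s) \<le> w s * ennreal b + w s * K (s + d) + w s * h (nat \<lfloor>s\<rfloor>)"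
    proof (cases "0 \<le> s")
      case True
      then have "ennreal (G s) \<le> ennreal b + K (s + d) + h (nat \<lfloor>s\<rfloor>)"
        using le[OF True] split[of "s + d"] d by simp
      then have "w s * ennreal (G s) \<le> w s * (ennreal b + K (s + d) + h (nat \<lfloor>s\<rfloor>))" by (rule mult_left_mono) simp
      then show ?thesis using True by (simp add: w_def distrib_left)
    qed (use G0 in simp)
  qed
  also have "\<dots> = (\<integral>\<^sup>+ s. w s * ennreal b \<partial>lborel) + (\<integral>\<^sup>+ s. w s * K (s + d) \<partial>lborel) + (\<integral>\<^sup>+ s. w s * h (nat \<lfloor>s\<rfloor>) \<partial>lborel)"
    by (simp add: nn_integral_add)
  also have "(\<integral>\<^sup>+ s. w s * K (s + d) \<partial>lborel) \<le> (\<integral>\<^sup>+ s. w s * K s \<partial>lborel) + (\<integral>\<^sup>+ s. w s * (ennreal (exp (q * d) - 1) * K s) \<partial>lborel)"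
  proof -
    have "(\<integral>\<^sup>+ s. w s * K (s + d) \<partial>lborel) = (\<integral>\<^sup>+ s. w (s - d) * K s \<partial>lborel)"
      using nn_integral_real_affine[of "\<lambda>s. w s * K (s + d)" 1 "- d"] by simp
    also have "\<dots> \<le> (\<integral>\<^sup>+ s. w s * K s + w s * (ennreal (exp (q * d) - 1) * K s) \<partial>lborel)"
    proof (rule nn_integral_mono)
      fix s :: real
      show "w (s - d) * K s \<le> w s * K s + w s * (ennreal (exp (q * d) - 1) * K s)"
      proof (cases "d \<le> s")
        case True
        \<comment> \<open>The shifted weight is \<open>exp (q * d)\<close> times the original one,
          written as the original plus an excess so that only the excess enters the error.\<close>
        have "q * exp (- q * (s - d)) = q * exp (- q * s) + q * exp (- q * s) * (exp (q * d) - 1)"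
          by (simp add: algebra_simps exp_diff exp_minus field_simps flip: exp_add)
        then have "w (s - d) = w s + w s * ennreal (exp (q * d) - 1)"
          using True d q by (simp add: w_def ennreal_mult'[symmetric] ennreal_plus[symmetric] del: ennreal_plus)
        then show ?thesis by (simp add: distrib_right mult.assoc)
      qed (simp add: w_def)
    qed
    also have "\<dots> = (\<integral>\<^sup>+ s. w s * K s \<partial>lborel) + (\<integral>\<^sup>+ s. w s * (ennreal (exp (q * d) - 1) * K s) \<partial>lborel)"
      by (simp add: nn_integral_add)
    finally show ?thesis .
  qed
  also have "(\<integral>\<^sup>+ s. w s * (ennreal (exp (q * d) - 1) * K s) \<partial>lborel)
     \<le> (\<integral>\<^sup>+ s. w s * (ennreal (exp (q * d) - 1) * k (nat \<lfloor>s\<rfloor>)) \<partial>lborel)"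
  proof (intro nn_integral_mono mult_left_mono)
    fix s show "K s \<le> k (nat \<lfloor>s\<rfloor>)" using k[of s] by (simp add: K_def indicator_def)
  qed simp_all
  also have "(\<integral>\<^sup>+ s. w s * ennreal b \<partial>lborel) +
       ((\<integral>\<^sup>+ s. w s * K s \<partial>lborel) + (\<integral>\<^sup>+ s. w s * (ennreal (exp (q * d) - 1) * k (nat \<lfloor>s\<rfloor>)) \<partial>lborel)) +
       (\<integral>\<^sup>+ s. w s * h (nat \<lfloor>s\<rfloor>) \<partial>lborel)
     = (\<integral>\<^sup>+ s. w s * (ennreal b + K s) \<partial>lborel) +
       (\<integral>\<^sup>+ s. w s * (h (nat \<lfloor>s\<rfloor>) + ennreal (exp (q * d) - 1) * k (nat \<lfloor>s\<rfloor>)) \<partial>lborel)"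
    by (simp add: nn_integral_add distrib_left ac_simps)
  also have "(\<integral>\<^sup>+ s. w s * (ennreal b + K s) \<partial>lborel) = (\<integral>\<^sup>+ s. ennreal (q * exp (- q * s)) * ennreal (H s) \<partial>lborel)"
  proof (rule nn_integral_cong)
    fix s show "w s * (ennreal b + K s) = ennreal (q * exp (- q * s)) * ennreal (H s)"
      using split[of s] H(2)[of s] by (cases "0 \<le> s") (auto simp: w_def)
  qed
  also have "(\<integral>\<^sup>+ s. w s * (h (nat \<lfloor>s\<rfloor>) + ennreal (exp (q * d) - 1) * k (nat \<lfloor>s\<rfloor>)) \<partial>lborel)
     \<le> (\<Sum>n. ennreal (q * exp (- q * real n)) * (h n + ennreal (exp (q * d) - 1) * k n))"
    unfolding w_def by (rule nn_integral_le_series[OF q, of "\<lambda>n. h n + ennreal (exp (q * d) - 1) * k n"])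
  finally show ?thesis by (simp add: add_mono)
qed

text \<open>The terms are the shortfall from a decrease of \<open>f\<close>, the shortfall on the
  event that \<open>\<bar>f\<bar>\<close> exceeds \<open>a\<close>, and the cost of the delay;
  neither \<open>x\<close> nor \<open>L\<close> occurs. For \<open>s < n + 1\<close> and
  \<open>d \<le> 1\<close> all times involved stay strictly below the horizon
  \<open>n + 3\<close>.\<close>

definition path_error :: "real \<Rightarrow> real \<Rightarrow> real \<Rightarrow> (real \<Rightarrow> real) \<Rightarrow> nat \<Rightarrow> ennreal" where
  "path_error q d a f n = drawdown f d (real n + 3) +
     2 * (if ennreal a < running_sup f (real n + 3) then running_sup f (real n + 3) else 0) +
     ennreal (exp (q * d) - 1) * (ennreal a + running_sup f (real n + 3))"

lemma discounted_dividends_le_lumped: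
  assumes f: "upward_cadlag (\<lambda>t. X t \<omega>)"
    and l: "mono_on {0..} (\<lambda>t. L t \<omega>)" "0 \<le> L 0 \<omega>"
    and rc: "\<And>t. 0 \<le> t \<Longrightarrow> continuous (at_right t) (\<lambda>s. L s \<omega>)"
    and adm: "\<And>t. 0 \<le> t \<Longrightarrow> ereal t \<le> ruin_time X x L \<omega> \<Longrightarrow> L t \<omega> \<le> x + X t \<omega>"
    and q: "0 < q" and d: "0 < d" "d \<le> 1" and a: "0 \<le> a" and x: "0 \<le> x"
  shows "discounted_dividends X q x L \<omega> \<le> discounted_dividends X q x (lumped d a x X L) \<omega> +
    (\<Sum>n. ennreal (q * exp (- q * real n)) * path_error q d a (\<lambda>t. X t \<omega>) n)"
proof -
  let ?f = "\<lambda>t. X t \<omega>" and ?L' = "lumped d a x X L"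
  let ?T = "ruin_time X x L \<omega>" and ?T' = "ruin_time X x ?L' \<omega>"
  let ?R = "\<lambda>n::nat. running_sup ?f (real n + 3)"
  have T: "0 \<le> ?T" "0 \<le> ?T'" by (rule ruin_time_nonneg)+
  have l': "mono_on {0..} (\<lambda>t. ?L' t \<omega>)" "0 \<le> ?L' 0 \<omega>"
    by (rule lumped_mono_on[OF d(1)], rule lumped_nonneg[OF d(1)]) simp
  have rc': "continuous (at_right t) (\<lambda>s. ?L' s \<omega>)" if "0 \<le> t" for t
    unfolding lumped_def by (rule step_max_right_continuous[OF d(1) that])
  have sup: "ennreal \<bar>?f r\<bar> \<le> ?R n" if "0 \<le> r" "r < real n + 3" for r n
    using upward_cadlagD(2)[OF f] that by (intro abs_le_running_sup) auto
  have eq: "discounted_dividends X q x L \<omega> =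
      (\<integral>\<^sup>+ s. ennreal (q * exp (- q * s)) * ennreal (paid ?T (\<lambda>t. L t \<omega>) s) \<partial>lborel)"
    by (rule discounted_dividends_eq[where L=L and \<omega>=\<omega>, OF q l]) (rule rc)
  have eq': "discounted_dividends X q x ?L' \<omega> =
      (\<integral>\<^sup>+ s. ennreal (q * exp (- q * s)) * ennreal (paid ?T' (\<lambda>t. ?L' t \<omega>) s) \<partial>lborel)"
    by (rule discounted_dividends_eq[where L="?L'" and \<omega>=\<omega>, OF q l']) (rule rc')
  show ?thesis
    unfolding eq eq' path_error_def
  proof (rule discounted_integral_shift[OF q d(1), where b = "max 0 (x - a)"])
    show "mono (paid ?T' (\<lambda>t. ?L' t \<omega>))" by (rule paid_mono[OF l' T(2)])
    show "max 0 (x - a) \<le> paid ?T' (\<lambda>t. ?L' t \<omega>) s" if "0 \<le> s" for s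
      unfolding paid_def using that stop_bounds(1)[OF T(2) that]
      by (simp add: lumped_ge_initial[where X=X and \<omega>=\<omega>, OF d(1) _ upward_cadlagD(1)[OF f] a x, simplified])
    show "ennreal (paid ?T' (\<lambda>t. ?L' t \<omega>) s - max 0 (x - a)) \<le> ennreal a + ?R (nat \<lfloor>s\<rfloor>)" if s: "0 \<le> s" for s
    proof -
      let ?s = "stop ?T' s"
      have "?L' ?s \<omega> \<le> x + X ?s \<omega>"
        using stop_bounds[OF T(2) s] by (intro lumped_le_surplus f d x)
      \<comment> \<open>Admissibility of the new strategy bounds its total by \<open>x + X\<close>,
        and subtracting at least \<open>x - a\<close> removes \<open>x\<close>.\<close>
      then have "paid ?T' (\<lambda>t. ?L' t \<omega>) s - max 0 (x - a) \<le> a + \<bar>X ?s \<omega>\<bar>"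
        using s by (auto simp: paid_def)
      then have "ennreal (paid ?T' (\<lambda>t. ?L' t \<omega>) s - max 0 (x - a)) \<le> ennreal (a + \<bar>X ?s \<omega>\<bar>)" by (rule ennreal_leI)
      also have "\<dots> = ennreal a + ennreal \<bar>X ?s \<omega>\<bar>" using a by simp
      also have "\<dots> \<le> ennreal a + ?R (nat \<lfloor>s\<rfloor>)"
        using stop_bounds[OF T(2) s] s by (intro add_left_mono sup) linarith+
      finally show ?thesis .
    qed
    show "ennreal (paid ?T (\<lambda>t. L t \<omega>) s) \<le> ennreal (paid ?T' (\<lambda>t. ?L' t \<omega>) (s + d)) +
      (drawdown ?f d (real (nat \<lfloor>s\<rfloor>) + 3) + 2 * (if ennreal a < ?R (nat \<lfloor>s\<rfloor>) then ?R (nat \<lfloor>s\<rfloor>) else 0))"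
      if s: "0 \<le> s" for s
    proof -
      let ?s = "stop ?T s" and ?s' = "stop ?T' (s + d)" and ?n = "nat \<lfloor>s\<rfloor>"
      have sd: "0 \<le> s + d" using s d by simp
      have st: "0 \<le> ?s" "?s \<le> s" using stop_bounds[OF T(1) s] by auto
      have L's: "0 \<le> ?L' ?s' \<omega>" using stop_bounds(1)[OF T(2) sd] by (rule lumped_nonneg[OF d(1)])
      have sn: "s + d < real ?n + 3" using s d by linarith
      have p: "paid ?T (\<lambda>t. L t \<omega>) s = L ?s \<omega>" "paid ?T' (\<lambda>t. ?L' t \<omega>) (s + d) = ?L' ?s' \<omega>"
        using s sd by (simp_all add: paid_def)
      have "(\<exists>r. ?s \<le> r \<and> r < ?s + d \<and> L ?s \<omega> \<le> ?L' ?s' \<omega> + (X ?s \<omega> - X r \<omega>)) \<or>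
          (\<exists>r. 0 \<le> r \<and> r < s + d \<and> X r \<omega> < - a \<and> L ?s \<omega> \<le> ?L' ?s' \<omega> + (a + X ?s \<omega>))"
        by (rule lumped_comparison[where X=X and L=L and \<omega>=\<omega>, OF f l _ d(1) a x s]) (rule adm)
      then show ?thesis
      proof (elim disjE exE conjE)
        fix r assume r: "?s \<le> r" "r < ?s + d" "L ?s \<omega> \<le> ?L' ?s' \<omega> + (X ?s \<omega> - X r \<omega>)"
        have "ennreal (L ?s \<omega>) \<le> ennreal (?L' ?s' \<omega> + (X ?s \<omega> - X r \<omega>))" using r(3) by (rule ennreal_leI)
        also have "\<dots> \<le> ennreal (?L' ?s' \<omega>) + ennreal (X ?s \<omega> - X r \<omega>)" by (rule ennreal_add_le[OF L's])
        also have "\<dots> \<le> ennreal (?L' ?s' \<omega>) + drawdown ?f d (real ?n + 3)"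
          using r st sn by (intro add_left_mono diff_le_drawdown upward_cadlagD(2)[OF f]) auto
        finally show ?thesis unfolding p by (auto intro: add_increasing2 simp: add.assoc[symmetric])
      next
        fix r assume r: "0 \<le> r" "r < s + d" "X r \<omega> < - a" "L ?s \<omega> \<le> ?L' ?s' \<omega> + (a + X ?s \<omega>)"
        have "ennreal a < ennreal \<bar>X r \<omega>\<bar>" using r(3) a by (simp add: ennreal_less_iff)
        also have "\<dots> \<le> ?R ?n" using r sn by (intro sup) auto
        finally have big: "ennreal a < ?R ?n" .
        have "ennreal (L ?s \<omega>) \<le> ennreal (?L' ?s' \<omega> + (a + X ?s \<omega>))" using r(4) by (rule ennreal_leI)
        also have "\<dots> \<le> ennreal (?L' ?s' \<omega>) + ennreal (a + X ?s \<omega>)" by (rule ennreal_add_le[OF L's])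
        also have "ennreal (a + X ?s \<omega>) \<le> ennreal a + ennreal (X ?s \<omega>)" by (rule ennreal_add_le[OF a])
        also have "ennreal (X ?s \<omega>) \<le> ennreal \<bar>X ?s \<omega>\<bar>" by (rule ennreal_leI) simp
        also have "\<dots> \<le> ?R ?n" using st sn d by (intro sup) auto
        \<comment> \<open>On this event the supremum exceeds \<open>a\<close> and absorbs it, which
          gives the factor 2 in \<open>path_error\<close>.\<close>
        also have "ennreal a + ?R ?n \<le> ?R ?n + ?R ?n" using big by (intro add_right_mono) simp
        also have "\<dots> = 2 * ?R ?n" by (simp add: mult_2)
        finally have "ennreal (L ?s \<omega>) \<le> ennreal (?L' ?s' \<omega>) + 2 * ?R ?n" by (simp add: add_left_mono)
        also have "\<dots> \<le> ennreal (?L' ?s' \<omega>) + (drawdown ?f d (real ?n + 3) + 2 * ?R ?n)"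
          by (intro add_left_mono) simp
        finally show ?thesis unfolding p using big by simp
      qed
    qed
  qed (simp_all add: paid_def)
qed

text \<open>Until ruin the total paid is at most \<open>x + X\<close>. The bound grows with
  \<open>x\<close>, but it only serves the finiteness of the value at each \<open>x\<close>.\<close>

lemma discounted_dividends_upper:
  assumes f: "upward_cadlag (\<lambda>t. X t \<omega>)"
    and l: "mono_on {0..} (\<lambda>t. L t \<omega>)" "0 \<le> L 0 \<omega>"
    and rc: "\<And>t. 0 \<le> t \<Longrightarrow> continuous (at_right t) (\<lambda>s. L s \<omega>)"
    and adm: "\<And>t. 0 \<le> t \<Longrightarrow> ereal t \<le> ruin_time X x L \<omega> \<Longrightarrow> L t \<omega> \<le> x + X t \<omega>"
    and q: "0 < q" and x: "0 \<le> x"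
  shows "discounted_dividends X q x L \<omega> \<le>
    (\<Sum>n. ennreal (q * exp (- q * real n)) * (ennreal x + running_sup (\<lambda>t. X t \<omega>) (real n + 1)))"
proof -
  let ?T = "ruin_time X x L \<omega>"
  let ?h = "\<lambda>n::nat. ennreal x + running_sup (\<lambda>t. X t \<omega>) (real n + 1)"
  have T: "0 \<le> ?T" by (rule ruin_time_nonneg)
  have eq: "discounted_dividends X q x L \<omega> =
      (\<integral>\<^sup>+ s. ennreal (q * exp (- q * s)) * ennreal (paid ?T (\<lambda>t. L t \<omega>) s) \<partial>lborel)"
    by (rule discounted_dividends_eq[where L=L and \<omega>=\<omega>, OF q l]) (rule rc)
  have "discounted_dividends X q x L \<omega> \<le>
      (\<integral>\<^sup>+ s. ennreal (q * exp (- q * s)) * indicator {0..} s * ?h (nat \<lfloor>s\<rfloor>) \<partial>lborel)"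
    unfolding eq
  proof (rule nn_integral_mono)
    fix s :: real
    show "ennreal (q * exp (- q * s)) * ennreal (paid ?T (\<lambda>t. L t \<omega>) s)
      \<le> ennreal (q * exp (- q * s)) * indicator {0..} s * ?h (nat \<lfloor>s\<rfloor>)"
    proof (cases "0 \<le> s")
      case True
      let ?s = "stop ?T s"
      have st: "0 \<le> ?s" "?s \<le> s" "ereal ?s \<le> ?T" using stop_bounds[OF T True] by auto
      have "L ?s \<omega> \<le> x + \<bar>X ?s \<omega>\<bar>" using adm[OF st(1,3)] by simp
      then have "ennreal (L ?s \<omega>) \<le> ennreal (x + \<bar>X ?s \<omega>\<bar>)" by (rule ennreal_leI)
      also have "\<dots> = ennreal x + ennreal \<bar>X ?s \<omega>\<bar>" using x by simp
      also have "\<dots> \<le> ?h (nat \<lfloor>s\<rfloor>)"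
      proof (rule add_left_mono, rule abs_le_running_sup[OF upward_cadlagD(2)[OF f]])
        show "?s < real (nat \<lfloor>s\<rfloor>) + 1" using st True by linarith
      qed (use st in auto)
      finally show ?thesis using True by (auto simp: paid_def intro!: mult_left_mono)
    qed (simp add: paid_def)
  qed
  also have "\<dots> \<le> (\<Sum>n. ennreal (q * exp (- q * real n)) * ?h n)"
    by (rule nn_integral_le_series[OF q])
  finally show ?thesis .
qed

section \<open>Adaptedness, admissibility and costs of the grid strategy\<close>

lemma space_natural_filtration: "space (natural_filtration M X t) = space M"
  by (simp add: natural_filtration_def space_measure_of_conv)

lemma sets_natural_filtration:
  "sets (natural_filtration M X t) =
     sigma_sets (space M) (\<Union>s\<in>{0..t}. {X s -` A \<inter> space M | A. A \<in> sets borel})"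
  unfolding natural_filtration_def by (rule sets_measure_of) auto

lemma measurable_natural_filtration:
  assumes "0 \<le> s" "s \<le> t"
  shows "X s \<in> borel_measurable (natural_filtration M X t)"
proof (rule measurableI)
  fix A :: "real set" assume "A \<in> sets borel"
  then show "X s -` A \<inter> space (natural_filtration M X t) \<in> sets (natural_filtration M X t)"
    unfolding space_natural_filtration sets_natural_filtration
    using assms by (intro sigma_sets.Basic UN_I[of s]) auto
qed simp

lemma natural_filtration_mono:
  assumes "s \<le> t" "g \<in> borel_measurable (natural_filtration M X s)"
  shows "g \<in> borel_measurable (natural_filtration M X t)"
proof -
  have "sets (natural_filtration M X s) \<subseteq> sets (natural_filtration M X t)"
    unfolding sets_natural_filtration using assms(1) by (intro sigma_sets_subseteq UN_mono) auto
  then show ?thesis using assms(2) by (auto simp: measurable_def space_natural_filtration)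
qed

text \<open>At time \<open>t\<close> the process is a maximum of finitely many functions, each known
  at a grid time up to \<open>t\<close>.\<close>

lemma dividend_process_lumped:
  assumes L: "dividend_process M X L" and d: "0 < d"
  shows "dividend_process M X (lumped d a x X L)"
  unfolding dividend_process_def
proof (intro conjI allI impI ballI)
  fix t :: real assume t: "0 \<le> t"
  have "(\<lambda>\<omega>. Max ((\<lambda>j. max 0 (min (max (L (real j * d) \<omega>) (x - a)) (x + X (real j * d) \<omega>))) ` {..nat \<lfloor>t / d\<rfloor>}))
    \<in> borel_measurable (natural_filtration M X t)"
  proof (intro borel_measurable_Max)
    fix j assume "j \<in> {..nat \<lfloor>t / d\<rfloor>}"
    then have j: "0 \<le> real j * d" "real j * d \<le> t" using le_nat_floor_divide_iff[OF d t, of j] d by auto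
    have [measurable]: "L (real j * d) \<in> borel_measurable (natural_filtration M X t)"
      using L j unfolding dividend_process_def by (intro natural_filtration_mono[OF j(2)]) blast
    have [measurable]: "X (real j * d) \<in> borel_measurable (natural_filtration M X t)"
      using j by (rule measurable_natural_filtration)
    show "(\<lambda>\<omega>. max 0 (min (max (L (real j * d) \<omega>) (x - a)) (x + X (real j * d) \<omega>))) \<in> borel_measurable (natural_filtration M X t)"
      by measurable
  qed simp
  moreover have "lumped d a x X L t = (\<lambda>\<omega>. Max ((\<lambda>j. max 0 (min (max (L (real j * d) \<omega>) (x - a)) (x + X (real j * d) \<omega>))) ` {..nat \<lfloor>t / d\<rfloor>}))"
    by (simp add: lumped_def step_max_def fun_eq_iff)
  ultimately show "lumped d a x X L t \<in> borel_measurable (natural_filtration M X t)" by simp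
next
  fix t :: real and \<omega> assume "0 \<le> t"
  then show "continuous (at_right t) (\<lambda>s. lumped d a x X L s \<omega>)"
    unfolding lumped_def by (rule step_max_right_continuous[OF d])
qed (use d in \<open>simp_all add: lumped_nonneg lumped_mono_on\<close>)

lemma dividend_processD:
  assumes "dividend_process M X L" "\<omega> \<in> space M"
  shows "mono_on {0..} (\<lambda>t. L t \<omega>)" "0 \<le> L 0 \<omega>" "\<And>t. 0 \<le> t \<Longrightarrow> continuous (at_right t) (\<lambda>s. L s \<omega>)"
  using assms unfolding dividend_process_def by auto

lemma pure_jump_lumped: "0 < d \<Longrightarrow> pure_jump M (lumped d a x X L)"
  unfolding pure_jump_def lumped_def using step_max_pure_jump by blast

text \<open>All jump times lie on the grid, so the geometric series over the whole grid dominates,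
  uniformly in \<open>x\<close>, \<open>a\<close>, \<open>L\<close> and \<omega>.\<close>

lemma discounted_costs_lumped:
  assumes q: "0 < q" and d: "0 < d" and \<beta>: "0 \<le> \<beta>"
  shows "discounted_costs X q \<beta> x (lumped d a x X L) \<omega> \<le> ennreal (\<beta> * (1 / (1 - exp (- q * d))))"
proof -
  let ?g = "\<lambda>k::nat. real k * d" and ?c = "\<lambda>t. ennreal (\<beta> * exp (- q * t))"
  define S where "S = {t \<in> lifetime X x (lumped d a x X L) \<omega>. 0 < jump 0 (\<lambda>s. lumped d a x X L s \<omega>) t}"
  have S: "S \<subseteq> range ?g"
  proof
    fix t assume t: "t \<in> S"
    then have "0 \<le> t" by (simp add: S_def lifetime_def)
    then show "t \<in> range ?g"
      using t step_max_jump(3)[OF d, of t "\<lambda>j. max 0 (min (max (L (real j * d) \<omega>) (x - a)) (x + X (real j * d) \<omega>))"]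
      unfolding S_def lumped_def by fastforce
  qed
  have "discounted_costs X q \<beta> x (lumped d a x X L) \<omega> = (\<integral>\<^sup>+ t. ?c t * indicator S t \<partial>count_space UNIV)"
    unfolding discounted_costs_def S_def[symmetric] by (rule nn_integral_count_space_indicator) simp
  also have "\<dots> \<le> (\<integral>\<^sup>+ t. ?c t * indicator (range ?g) t \<partial>count_space UNIV)"
    using S by (intro nn_integral_mono mult_left_mono) (auto simp: indicator_def)
  also have "\<dots> = (\<integral>\<^sup>+ t. ?c t \<partial>count_space (range ?g))"
    by (rule nn_integral_count_space_indicator[symmetric]) simp
  also have "\<dots> = (\<integral>\<^sup>+ k. ?c (?g k) \<partial>count_space UNIV)"
    using d by (intro nn_integral_bij_count_space[symmetric] inj_on_imp_bij_betw) (auto simp: inj_on_def)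
  also have "\<dots> = (\<Sum>k. ?c (?g k))" by (rule nn_integral_count_space_nat)
  also have "\<dots> = ennreal (\<beta> * (1 / (1 - exp (- q * d))))"
  proof (rule suminf_ennreal_eq)
    have "(\<lambda>k. exp (- q * d) ^ k) sums (1 / (1 - exp (- q * d)))"
      using q d by (intro geometric_sums) auto
    then have "(\<lambda>k. \<beta> * exp (- q * d) ^ k) sums (\<beta> * (1 / (1 - exp (- q * d))))" by (rule sums_mult)
    moreover have "exp (- q * d) ^ k = exp (- q * ?g k)" for k
      by (simp add: exp_of_nat_mult[symmetric] ac_simps)
    ultimately show "(\<lambda>k. \<beta> * exp (- q * ?g k)) sums (\<beta> * (1 / (1 - exp (- q * d))))" by simp
  qed (use \<beta> in simp)
  finally show ?thesis .
qed

context spectrally_positive_levy_process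
begin

lemma admissible_strategiesD:
  assumes "L \<in> admissible_strategies M X x"
  shows "dividend_process M X L"
    "AE \<omega> in M. \<forall>t\<ge>0. ereal t \<le> ruin_time X x L \<omega> \<longrightarrow> L t \<omega> \<le> x + X t \<omega>"
proof -
  show L: "dividend_process M X L" using assms by (simp add: admissible_strategies_def)
  have "AE \<omega> in M. \<forall>t\<ge>0. ereal t \<le> ruin_time X x L \<omega> \<longrightarrow>
      jump 0 (\<lambda>s. L s \<omega>) t \<le> left_value x (surplus X x L \<omega>) t + jump 0 (\<lambda>s. X s \<omega>) t"
    using assms by (simp add: admissible_strategies_def)
  then show "AE \<omega> in M. \<forall>t\<ge>0. ereal t \<le> ruin_time X x L \<omega> \<longrightarrow> L t \<omega> \<le> x + X t \<omega>"
    using AE_upward_cadlag AE_space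
  proof eventually_elim
    case (elim \<omega>)
    then show ?case using jump_constraint_iff[where X=X and L=L and \<omega>=\<omega>, OF elim(2) dividend_processD(1)[OF L elim(3)]] by blast
  qed
qed

text \<open>The cap in every payment enforces the constraint, so any dividend process is turned into
  an admissible strategy.\<close>

lemma lumped_admissible:
  assumes L: "dividend_process M X L" and d: "0 < d" and x: "0 \<le> x"
  shows "lumped d a x X L \<in> admissible_strategies M X x"
proof -
  have "AE \<omega> in M. \<forall>t\<ge>0. ereal t \<le> ruin_time X x (lumped d a x X L) \<omega> \<longrightarrow>
      jump 0 (\<lambda>s. lumped d a x X L s \<omega>) t
        \<le> left_value x (surplus X x (lumped d a x X L) \<omega>) t + jump 0 (\<lambda>s. X s \<omega>) t"
    using AE_upward_cadlag
  proof eventually_elim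
    case (elim \<omega>)
    then show ?case
      using jump_constraint_iff[where X=X and L="lumped d a x X L" and \<omega>=\<omega>, OF elim lumped_mono_on[OF d]] lumped_le_surplus[where X=X and \<omega>=\<omega>, OF elim d x]
      by blast
  qed
  then show ?thesis using dividend_process_lumped[OF L d] by (simp add: admissible_strategies_def)
qed

end

text \<open>Without measurability \<open>nn_integral\<close> is a lower integral, for which
  subadditivity can fail. It holds if one summand is measurable: a simple function below
  \<open>g + h\<close>, minus \<open>h\<close>, is measurable and lies below \<open>g\<close>. In
  the comparison of strategies \<open>f\<close> and \<open>g\<close> are discounted dividends and
  \<open>h\<close> is the path error.\<close>

lemma nn_integral_le_add_measurable:
  assumes h[measurable]: "h \<in> borel_measurable M" and le: "AE \<omega> in M. f \<omega> \<le> g \<omega> + h \<omega>"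
  shows "(\<integral>\<^sup>+ \<omega>. f \<omega> \<partial>M) \<le> (\<integral>\<^sup>+ \<omega>. g \<omega> \<partial>M) + (\<integral>\<^sup>+ \<omega>. h \<omega> \<partial>M)"
proof -
  \<comment> \<open>The minimum turns the almost sure bound into one that holds everywhere.\<close>
  have "(\<integral>\<^sup>+ \<omega>. f \<omega> \<partial>M) = (\<integral>\<^sup>+ \<omega>. min (f \<omega>) (g \<omega> + h \<omega>) \<partial>M)"
    using le by (intro nn_integral_cong_AE) (auto simp: min_absorb1)
  also have "\<dots> \<le> (\<integral>\<^sup>+ \<omega>. g \<omega> \<partial>M) + (\<integral>\<^sup>+ \<omega>. h \<omega> \<partial>M)"
    unfolding nn_integral_def[of M "\<lambda>\<omega>. min (f \<omega>) (g \<omega> + h \<omega>)"]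
  proof (rule SUP_least)
    fix \<phi> assume "\<phi> \<in> {\<phi>. simple_function M \<phi> \<and> \<phi> \<le> (\<lambda>\<omega>. min (f \<omega>) (g \<omega> + h \<omega>))}"
    then have s: "simple_function M \<phi>" and le: "\<phi> \<omega> \<le> g \<omega> + h \<omega>" for \<omega> by (auto simp: le_fun_def)
    have [measurable]: "\<phi> \<in> borel_measurable M" using s by (rule borel_measurable_simple_function)
    \<comment> \<open>Where \<open>h\<close> is infinite the subtraction could give
      \<open>top - top = top\<close>, which need not lie below \<open>g\<close>.\<close>
    define \<psi> where "\<psi> \<omega> = (if h \<omega> = top then 0 else \<phi> \<omega> - h \<omega>)" for \<omega>
    have [measurable]: "\<psi> \<in> borel_measurable M" unfolding \<psi>_def by measurable
    have "integral\<^sup>S M \<phi> = (\<integral>\<^sup>+ \<omega>. \<phi> \<omega> \<partial>M)" using s by (rule nn_integral_eq_simple_integral[symmetric])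
    also have "\<dots> \<le> (\<integral>\<^sup>+ \<omega>. \<psi> \<omega> + h \<omega> \<partial>M)"
    proof (rule nn_integral_mono)
      fix \<omega> show "\<phi> \<omega> \<le> \<psi> \<omega> + h \<omega>"
        unfolding \<psi>_def by (cases "\<phi> \<omega> \<le> h \<omega>") (auto simp: add_increasing diff_add_cancel_ennreal)
    qed
    also have "\<dots> = (\<integral>\<^sup>+ \<omega>. \<psi> \<omega> \<partial>M) + (\<integral>\<^sup>+ \<omega>. h \<omega> \<partial>M)" by (rule nn_integral_add) measurable
    also have "(\<integral>\<^sup>+ \<omega>. \<psi> \<omega> \<partial>M) \<le> (\<integral>\<^sup>+ \<omega>. g \<omega> \<partial>M)"
      using le unfolding \<psi>_def by (intro nn_integral_mono) (auto simp: ennreal_minus_le_iff add.commute)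
    finally show "integral\<^sup>S M \<phi> \<le> (\<integral>\<^sup>+ \<omega>. g \<omega> \<partial>M) + (\<integral>\<^sup>+ \<omega>. h \<omega> \<partial>M)" by (simp add: add_right_mono)
  qed
  finally show ?thesis .
qed

lemma e2ennreal_diff: "e2ennreal (enn2ereal a - enn2ereal b) = a - b"
  by transfer (simp add: max_def)

lemma ereal_expectation_enn2ereal:
  "ereal_expectation M (\<lambda>\<omega>. enn2ereal (D \<omega>)) = enn2ereal (\<integral>\<^sup>+ \<omega>. D \<omega> \<partial>M)"
proof -
  have "e2ennreal (- enn2ereal (D \<omega>)) = 0" for \<omega>
    by (rule e2ennreal_neg) simp
  then show ?thesis by (simp add: ereal_expectation_def zero_ennreal.rep_eq)
qed

lemma ereal_expectation_diff_le:
  "ereal_expectation M (\<lambda>\<omega>. enn2ereal (D \<omega>) - enn2ereal (C \<omega>)) \<le> enn2ereal (\<integral>\<^sup>+ \<omega>. D \<omega> \<partial>M)"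
proof -
  have "(\<integral>\<^sup>+ \<omega>. e2ennreal (enn2ereal (D \<omega>) - enn2ereal (C \<omega>)) \<partial>M) \<le> (\<integral>\<^sup>+ \<omega>. D \<omega> \<partial>M)"
    unfolding e2ennreal_diff by (intro nn_integral_mono diff_le_self_ennreal)
  then have "enn2ereal (\<integral>\<^sup>+ \<omega>. e2ennreal (enn2ereal (D \<omega>) - enn2ereal (C \<omega>)) \<partial>M) - enn2ereal (\<integral>\<^sup>+ \<omega>. e2ennreal (- (enn2ereal (D \<omega>) - enn2ereal (C \<omega>))) \<partial>M)
     \<le> enn2ereal (\<integral>\<^sup>+ \<omega>. D \<omega> \<partial>M) - 0"
    by (intro ereal_minus_mono) (auto simp: less_eq_ennreal.rep_eq)
  then show ?thesis by (simp add: ereal_expectation_def)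
qed

text \<open>\<open>D\<close> need not be measurable, so \<open>K\<close> is lost once in the positive and once in the negative part.\<close>

lemma (in prob_space) ereal_expectation_diff_ge:
  assumes C: "\<And>\<omega>. C \<omega> \<le> ennreal K" and K: "0 \<le> K"
  shows "enn2ereal (\<integral>\<^sup>+ \<omega>. D \<omega> \<partial>M) \<le> ereal_expectation M (\<lambda>\<omega>. enn2ereal (D \<omega>) - enn2ereal (C \<omega>)) + ereal (2 * K)"
proof -
  let ?P = "\<integral>\<^sup>+ \<omega>. e2ennreal (enn2ereal (D \<omega>) - enn2ereal (C \<omega>)) \<partial>M"
  let ?N = "\<integral>\<^sup>+ \<omega>. e2ennreal (- (enn2ereal (D \<omega>) - enn2ereal (C \<omega>))) \<partial>M"
  have "(\<integral>\<^sup>+ \<omega>. D \<omega> \<partial>M) \<le> ?P + (\<integral>\<^sup>+ \<omega>. ennreal K \<partial>M)"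
  proof (rule nn_integral_le_add_measurable)
    have "D \<omega> \<le> (D \<omega> - C \<omega>) + ennreal K" for \<omega>
    proof -
      have "D \<omega> \<le> (D \<omega> - C \<omega>) + C \<omega>" by (cases "D \<omega> \<le> C \<omega>") (auto simp: add_increasing diff_add_cancel_ennreal)
      also have "\<dots> \<le> (D \<omega> - C \<omega>) + ennreal K" by (intro add_left_mono C)
      finally show ?thesis .
    qed
    then show "AE \<omega> in M. D \<omega> \<le> e2ennreal (enn2ereal (D \<omega>) - enn2ereal (C \<omega>)) + ennreal K"
      unfolding e2ennreal_diff by simp
  qed simp
  then have P: "(\<integral>\<^sup>+ \<omega>. D \<omega> \<partial>M) \<le> ?P + ennreal K" by (simp add: emeasure_space_1)
  have "?N \<le> (\<integral>\<^sup>+ \<omega>. ennreal K \<partial>M)"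
  proof (rule nn_integral_mono)
    fix \<omega>
    have "enn2ereal (C \<omega>) \<le> ereal K" using C[of \<omega>] K by (simp add: less_eq_ennreal.rep_eq enn2ereal_ennreal)
    moreover have "0 \<le> enn2ereal (C \<omega>)" "0 \<le> enn2ereal (D \<omega>)" by simp_all
    ultimately have "- (enn2ereal (D \<omega>) - enn2ereal (C \<omega>)) \<le> ereal K"
      by (cases "enn2ereal (D \<omega>)"; cases "enn2ereal (C \<omega>)") auto
    then have "e2ennreal (- (enn2ereal (D \<omega>) - enn2ereal (C \<omega>))) \<le> e2ennreal (ereal K)" by (rule e2ennreal_mono)
    then show "e2ennreal (- (enn2ereal (D \<omega>) - enn2ereal (C \<omega>))) \<le> ennreal K" by (simp add: ennreal.abs_eq)
  qed
  then have N: "?N \<le> ennreal K" by (simp add: emeasure_space_1)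
  \<comment> \<open>The negative part is finite, so the difference in
    \<open>ereal_expectation\<close> never takes the form infinity minus infinity.\<close>
  from N obtain n where n: "?N = ennreal n" "0 \<le> n" by (cases ?N) (auto simp: top_unique)
  with N K have nK: "n \<le> K" by simp
  have "enn2ereal (\<integral>\<^sup>+ \<omega>. D \<omega> \<partial>M) \<le> enn2ereal ?P + ereal K"
    using P K by (simp add: less_eq_ennreal.rep_eq plus_ennreal.rep_eq enn2ereal_ennreal)
  also have "\<dots> \<le> (enn2ereal ?P - ereal n) + ereal (2 * K)"
    using nK by (cases "enn2ereal ?P") auto
  finally show ?thesis using n by (simp add: ereal_expectation_def enn2ereal_ennreal)
qed

subsection \<open>Convergence\<close>

lemma ennreal_tendsto_0I:
  assumes "\<And>e::real. 0 < e \<Longrightarrow> eventually (\<lambda>m. g m \<le> ennreal e) F"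
  shows "(g \<longlongrightarrow> (0::ennreal)) F"
proof (rule order_tendstoI)
  fix y :: ennreal assume "0 < y"
  then obtain z where z: "0 < z" "z < y" using dense by blast
  then obtain e where e: "z = ennreal e" "0 < e" by (cases z) (auto simp: ennreal_less_zero_iff)
  show "eventually (\<lambda>m. g m < y) F"
    using assms[OF e(2)] by eventually_elim (use z e in \<open>auto intro: le_less_trans\<close>)
qed simp

section \<open>Joint choice of grid width and threshold\<close>

definition mesh :: "nat \<Rightarrow> real" where
  "mesh m = 1 / (real m + 1)\<^sup>2"

lemma mesh_bounds: "0 < mesh m" "mesh m \<le> 1"
  by (auto simp: mesh_def field_simps)

lemma mesh_tendsto: "mesh \<longlonglongrightarrow> 0"
proof (rule tendsto_sandwich[OF _ _ tendsto_const LIMSEQ_inverse_real_of_nat])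
  show "eventually (\<lambda>m. mesh m \<le> inverse (real (Suc m))) sequentially"
  proof (intro always_eventually allI)
    fix m
    have "1 / (real m + 1)\<^sup>2 \<le> 1 / (real m + 1)"
      by (intro divide_left_mono) (auto simp: self_le_power)
    then show "mesh m \<le> inverse (real (Suc m))" by (simp add: mesh_def inverse_eq_divide add.commute)
  qed
  show "eventually (\<lambda>m. 0 \<le> mesh m) sequentially"
    by (intro always_eventually allI less_imp_le mesh_bounds)
qed

text \<open>The quadratic mesh beats the linear growth of the threshold \<open>m\<close>.\<close>

lemma exp_mesh_bound:
  assumes q: "0 < q"
  shows "ennreal (exp (q * mesh m) - 1) * (ennreal (real m) + R) \<le> ennreal (q * exp q / (real m + 1)) * (1 + R)"
proof -
  \<comment> \<open>This is \<open>1 - y \<le> exp (- y)\<close> for \<open>y = q * mesh m\<close>,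
    multiplied by \<open>exp y\<close>.\<close>
  have "exp (q * mesh m) - 1 \<le> q * mesh m * exp (q * mesh m)"
  proof -
    have "1 - q * mesh m \<le> exp (- (q * mesh m))" using exp_ge_add_one_self[of "- (q * mesh m)"] by simp
    then have "(1 - q * mesh m) * exp (q * mesh m) \<le> exp (- (q * mesh m)) * exp (q * mesh m)"
      by (rule mult_right_mono) simp
    then show ?thesis by (simp add: exp_minus algebra_simps)
  qed
  also have "\<dots> \<le> q * mesh m * exp q"
    using q mesh_bounds[of m] by (intro mult_left_mono) (auto simp: mult_left_le less_imp_le)
  finally have "exp (q * mesh m) - 1 \<le> q * mesh m * exp q" .
  then have "ennreal (exp (q * mesh m) - 1) \<le> ennreal (q * mesh m * exp q)" by (rule ennreal_leI)
  moreover have "ennreal (real m) + R \<le> ennreal (real m + 1) * (1 + R)"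
  proof -
    have "R \<le> ennreal (real m + 1) * R"
      using mult_right_mono[of 1 "ennreal (real m + 1)" R] by (simp add: ennreal_ge_1)
    moreover have "ennreal (real m) \<le> ennreal (real m + 1)" by (rule ennreal_leI) simp
    ultimately show ?thesis by (simp add: distrib_left add_mono)
  qed
  ultimately have "ennreal (exp (q * mesh m) - 1) * (ennreal (real m) + R)
      \<le> ennreal (q * mesh m * exp q) * (ennreal (real m + 1) * (1 + R))" by (rule mult_mono) simp_all
  also have "\<dots> = ennreal (q * mesh m * exp q * (real m + 1)) * (1 + R)"
    using q mesh_bounds[of m] by (simp add: ennreal_mult mult.assoc)
  also have "q * mesh m * exp q * (real m + 1) = q * exp q / (real m + 1)"
    by (simp add: mesh_def power2_eq_square)
  finally show ?thesis .
qed

text \<open>The right-hand side is free of \<open>m\<close>, and for the paths of \<open>X\<close>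
  its mean grows at most linearly in \<open>n\<close>; it is the majorant for the limit in
  \<open>m\<close>.\<close>

lemma path_error_bound:
  assumes q: "0 < q"
  shows "path_error q (mesh m) (real m) f n
    \<le> ennreal (4 + q * exp q) * running_sup f (real n + 3) + ennreal (q * exp q)"
proof -
  let ?R = "running_sup f (real n + 3)" and ?c = "ennreal (q * exp q)"
  have "path_error q (mesh m) (real m) f n \<le> 2 * ?R + 2 * ?R + ?c * (1 + ?R)"
    unfolding path_error_def
  proof (intro add_mono mult_left_mono drawdown_le_running_sup)
    have "ennreal (exp (q * mesh m) - 1) * (ennreal (real m) + ?R) \<le> ennreal (q * exp q / (real m + 1)) * (1 + ?R)"
      by (rule exp_mesh_bound[OF q])
    also have "\<dots> \<le> ?c * (1 + ?R)"
      using q by (intro mult_right_mono ennreal_leI) (auto simp: field_simps)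
    finally show "ennreal (exp (q * mesh m) - 1) * (ennreal (real m) + ?R) \<le> ?c * (1 + ?R)" .
  qed auto
  also have "2 * ?R + 2 * ?R = 4 * ?R" by (simp flip: distrib_right)
  also have "4 * ?R + ?c * (1 + ?R) = (4 + ?c) * ?R + ?c" by (simp add: distrib_left distrib_right ac_simps)
  also have "4 + ?c = ennreal (4 + q * exp q)" using q by (simp add: ennreal_plus)
  finally show ?thesis .
qed

text \<open>On a fixed path the supremum is finite: the second term vanishes once \<open>m\<close>
  exceeds it, and the delay term is of order \<open>1 / m\<close>. For the drawdown term the absence
  of negative jumps is decisive.\<close>

lemma path_error_tendsto_0:
  assumes f: "upward_cadlag f" and q: "0 < q"
  shows "(\<lambda>m. path_error q (mesh m) (real m) f n) \<longlonglongrightarrow> 0"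
proof -
  let ?T = "real n + 3"
  obtain r where r: "running_sup f ?T = ennreal r" "0 \<le> r"
    using running_sup_finite[OF upward_cadlagD(2,3)[OF f], of ?T] by (cases "running_sup f ?T") auto
  have 1: "(\<lambda>m. drawdown f (mesh m) ?T) \<longlonglongrightarrow> 0"
  proof (rule ennreal_tendsto_0I)
    fix e :: real assume "0 < e"
    then obtain d0 where d0: "0 < d0" "\<And>d. d < d0 \<Longrightarrow> drawdown f d ?T \<le> ennreal e"
      using drawdown_vanishes[OF f] by blast
    show "eventually (\<lambda>m. drawdown f (mesh m) ?T \<le> ennreal e) sequentially"
      using order_tendstoD(2)[OF mesh_tendsto d0(1)] by eventually_elim (rule d0(2))
  qed
  have 2: "(\<lambda>m. 2 * (if ennreal (real m) < running_sup f ?T then running_sup f ?T else 0)) \<longlonglongrightarrow> 0"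
  proof (rule tendsto_eventually)
    obtain N :: nat where N: "r \<le> real N" using real_arch_simple by blast
    show "eventually (\<lambda>m. 2 * (if ennreal (real m) < running_sup f ?T then running_sup f ?T else 0) = 0) sequentially"
      using eventually_ge_at_top[of N]
    proof eventually_elim
      case (elim m)
      then have "r \<le> real m" using N by linarith
      then have "\<not> ennreal (real m) < running_sup f ?T" using r by (simp add: ennreal_less_iff)
      then show ?case by simp
    qed
  qed
  have 3: "(\<lambda>m. ennreal (exp (q * mesh m) - 1) * (ennreal (real m) + running_sup f ?T)) \<longlonglongrightarrow> 0"
  proof (rule tendsto_sandwich[OF _ _ tendsto_const])
    show "eventually (\<lambda>m. ennreal (exp (q * mesh m) - 1) * (ennreal (real m) + running_sup f ?T)
        \<le> ennreal (q * exp q * (1 + r) * inverse (real (Suc m)))) sequentially"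
    proof (intro always_eventually allI)
      fix m
      have "ennreal (exp (q * mesh m) - 1) * (ennreal (real m) + running_sup f ?T)
        \<le> ennreal (q * exp q / (real m + 1)) * (1 + running_sup f ?T)" by (rule exp_mesh_bound[OF q])
      also have "\<dots> = ennreal (q * exp q / (real m + 1)) * ennreal (1 + r)" using r by simp
      also have "\<dots> = ennreal (q * exp q / (real m + 1) * (1 + r))"
        using q r by (intro ennreal_mult[symmetric]) auto
      also have "q * exp q / (real m + 1) * (1 + r) = q * exp q * (1 + r) * inverse (real (Suc m))"
        by (simp add: divide_inverse ac_simps)
      finally show "ennreal (exp (q * mesh m) - 1) * (ennreal (real m) + running_sup f ?T)
        \<le> ennreal (q * exp q * (1 + r) * inverse (real (Suc m)))" .
    qed
    have "(\<lambda>m. q * exp q * (1 + r) * inverse (real (Suc m))) \<longlonglongrightarrow> q * exp q * (1 + r) * 0"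
      by (intro tendsto_mult tendsto_const LIMSEQ_inverse_real_of_nat)
    then show "(\<lambda>m. ennreal (q * exp q * (1 + r) * inverse (real (Suc m)))) \<longlonglongrightarrow> 0"
      using tendsto_ennrealI by fastforce
  qed simp
  show ?thesis using tendsto_add[OF tendsto_add[OF 1 2] 3] by (simp add: path_error_def)
qed

text \<open>The sum of \<open>(n + 1) * exp (- q) ^ n\<close> is a differentiated geometric
  series.\<close>

lemma discounted_linear_series_finite:
  assumes q: "0 < q" and K: "0 \<le> K"
  shows "(\<Sum>n. ennreal (q * exp (- q * real n)) * ennreal (K * (real n + 1))) < top"
proof -
  have "(\<lambda>n. of_nat (Suc n) * exp (- q) ^ n) sums (1 / (1 - exp (- q))\<^sup>2)"
    using q by (intro geometric_deriv_sums) simp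
  then have "(\<lambda>n. q * K * (real (Suc n) * exp (- q) ^ n)) sums (q * K * (1 / (1 - exp (- q))\<^sup>2))" by (rule sums_mult)
  moreover have eq: "q * K * (real (Suc n) * exp (- q) ^ n) = q * exp (- q * real n) * (K * (real n + 1))" for n
    by (simp add: exp_of_nat_mult[symmetric] ac_simps)
  ultimately have "(\<lambda>n. q * exp (- q * real n) * (K * (real n + 1))) sums (q * K * (1 / (1 - exp (- q))\<^sup>2))"
    unfolding eq by blast
  then have "(\<Sum>n. ennreal (q * exp (- q * real n) * (K * (real n + 1)))) = ennreal (q * K * (1 / (1 - exp (- q))\<^sup>2))"
    using q K by (intro suminf_ennreal_eq) auto
  then show ?thesis using q K by (simp add: ennreal_mult)
qed

section \<open>The expected error and the two value functions\<close>

context spectrally_positive_levy_process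
begin

lemma path_error_measurable[measurable]: "(\<lambda>\<omega>. path_error q d a (\<lambda>t. X t \<omega>) n) \<in> borel_measurable M"
  unfolding path_error_def by measurable

text \<open>Dominated convergence is applied twice: over \<omega> for fixed \<open>n\<close>, then
  over \<open>n\<close> with respect to counting measure. Grid width and threshold are driven by the
  same index \<open>m\<close>, so one limit handles all three error terms.\<close>

lemma expected_path_error_small:
  assumes int: "integrable M (X 1)" and q: "0 < q" and e: "0 < (e::real)"
  shows "\<exists>d a. 0 < d \<and> d \<le> 1 \<and> 0 \<le> a \<and>
    (\<integral>\<^sup>+ \<omega>. (\<Sum>n. ennreal (q * exp (- q * real n)) * path_error q d a (\<lambda>t. X t \<omega>) n) \<partial>M) \<le> ennreal e"
proof -
  obtain C where C: "0 \<le> C" "\<And>N::nat. (\<integral>\<^sup>+ \<omega>. running_sup (\<lambda>t. X t \<omega>) (real N) \<partial>M) \<le> ennreal (C * (1 + real N))"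
    using expected_running_sup_linear[OF int] by blast
  define c where "c = q * exp q"
  have c: "0 \<le> c" using q by (simp add: c_def)
  \<comment> \<open>The factor 4 in \<open>4 * C\<close> comes from
    \<open>n + 4 \<le> 4 * (n + 1)\<close>, as the supremum runs up to \<open>n + 3\<close>.\<close>
  define K where "K = (4 + c) * (4 * C) + c"
  have K: "0 \<le> K" using c C(1) by (simp add: K_def)
  define B where "B n \<omega> = ennreal (4 + c) * running_sup (\<lambda>t. X t \<omega>) (real n + 3) + ennreal c" for n :: nat and \<omega>
  define err where "err m n \<omega> = path_error q (mesh m) (real m) (\<lambda>t. X t \<omega>) n" for m n \<omega>
  have [measurable]: "B n \<in> borel_measurable M" "err m n \<in> borel_measurable M" for m n
    unfolding B_def err_def by measurable
  have errB: "err m n \<omega> \<le> B n \<omega>" for m n \<omega>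
    unfolding err_def B_def c_def by (rule path_error_bound[OF q])
  have EB: "(\<integral>\<^sup>+ \<omega>. B n \<omega> \<partial>M) \<le> ennreal (K * (real n + 1))" for n
  proof -
    have "(\<integral>\<^sup>+ \<omega>. B n \<omega> \<partial>M) = ennreal (4 + c) * (\<integral>\<^sup>+ \<omega>. running_sup (\<lambda>t. X t \<omega>) (real (n + 3)) \<partial>M) + ennreal c"
      unfolding B_def by (simp add: nn_integral_add nn_integral_cmult emeasure_space_1)
    also have "\<dots> \<le> ennreal (4 + c) * ennreal (C * (1 + real (n + 3))) + ennreal c"
      by (intro add_right_mono mult_left_mono C(2)) simp
    also have "\<dots> = ennreal ((4 + c) * (C * (1 + real (n + 3))) + c)"
      using c C(1) by (simp add: ennreal_mult'[symmetric] ennreal_plus[symmetric] del: ennreal_plus)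
    also have "\<dots> \<le> ennreal (K * (real n + 1))"
    proof (rule ennreal_leI)
      have "C * (1 + real (n + 3)) \<le> 4 * C * (real n + 1)" using C(1) by (simp add: algebra_simps)
      then have "(4 + c) * (C * (1 + real (n + 3))) \<le> (4 + c) * (4 * C * (real n + 1))" using c by (intro mult_left_mono) auto
      moreover have "c \<le> c * (real n + 1)" using c by (simp add: algebra_simps)
      ultimately show "(4 + c) * (C * (1 + real (n + 3))) + c \<le> K * (real n + 1)" by (simp add: K_def algebra_simps)
    qed
    finally show ?thesis .
  qed
  have lim: "(\<lambda>m. \<integral>\<^sup>+ \<omega>. err m n \<omega> \<partial>M) \<longlonglongrightarrow> 0" for n
  proof -
    have "(\<lambda>m. \<integral>\<^sup>+ \<omega>. err m n \<omega> \<partial>M) \<longlonglongrightarrow> (\<integral>\<^sup>+ \<omega>. 0 \<partial>M)"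
    proof (rule nn_integral_dominated_convergence[where w = "B n"])
      show "AE \<omega> in M. err m n \<omega> \<le> B n \<omega>" for m using errB by simp
      show "(\<integral>\<^sup>+ \<omega>. B n \<omega> \<partial>M) < \<infinity>" using EB[of n] by (auto intro: le_less_trans)
      show "AE \<omega> in M. (\<lambda>m. err m n \<omega>) \<longlonglongrightarrow> 0"
        using AE_upward_cadlag unfolding err_def by eventually_elim (rule path_error_tendsto_0[OF _ q])
    qed measurable
    then show ?thesis by simp
  qed
  define w where "w n = ennreal (q * exp (- q * real n))" for n :: nat
  have "(\<lambda>m. \<integral>\<^sup>+ n. w n * (\<integral>\<^sup>+ \<omega>. err m n \<omega> \<partial>M) \<partial>count_space UNIV) \<longlonglongrightarrow> (\<integral>\<^sup>+ n. 0 \<partial>count_space (UNIV :: nat set))"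
  proof (rule nn_integral_dominated_convergence[where w = "\<lambda>n. w n * ennreal (K * (real n + 1))"])
    show "AE n in count_space UNIV. w n * (\<integral>\<^sup>+ \<omega>. err m n \<omega> \<partial>M) \<le> w n * ennreal (K * (real n + 1))" for m
    proof (intro AE_I2 mult_left_mono)
      fix n show "(\<integral>\<^sup>+ \<omega>. err m n \<omega> \<partial>M) \<le> ennreal (K * (real n + 1))"
        using order_trans[OF nn_integral_mono[OF errB] EB] .
    qed simp
    show "(\<integral>\<^sup>+ n. w n * ennreal (K * (real n + 1)) \<partial>count_space UNIV) < \<infinity>"
      using discounted_linear_series_finite[OF q K] by (simp add: nn_integral_count_space_nat w_def)
    show "AE n in count_space UNIV. (\<lambda>m. w n * (\<integral>\<^sup>+ \<omega>. err m n \<omega> \<partial>M)) \<longlonglongrightarrow> 0"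
    proof (intro AE_I2)
      fix n
      have "(\<lambda>m. w n * (\<integral>\<^sup>+ \<omega>. err m n \<omega> \<partial>M)) \<longlonglongrightarrow> w n * 0"
        by (rule ennreal_tendsto_cmult[OF _ lim]) (simp add: w_def)
      then show "(\<lambda>m. w n * (\<integral>\<^sup>+ \<omega>. err m n \<omega> \<partial>M)) \<longlonglongrightarrow> 0" by simp
    qed
  qed simp_all
  then have "(\<lambda>m. \<Sum>n. w n * (\<integral>\<^sup>+ \<omega>. err m n \<omega> \<partial>M)) \<longlonglongrightarrow> 0"
    by (simp add: nn_integral_count_space_nat)
  then have "eventually (\<lambda>m. (\<Sum>n. w n * (\<integral>\<^sup>+ \<omega>. err m n \<omega> \<partial>M)) < ennreal e) sequentially"
    using e by (intro order_tendstoD) auto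
  then obtain m where m: "(\<Sum>n. w n * (\<integral>\<^sup>+ \<omega>. err m n \<omega> \<partial>M)) < ennreal e"
    by (auto simp: eventually_sequentially)
  have "(\<integral>\<^sup>+ \<omega>. (\<Sum>n. w n * err m n \<omega>) \<partial>M) = (\<Sum>n. w n * (\<integral>\<^sup>+ \<omega>. err m n \<omega> \<partial>M))"
    by (subst nn_integral_suminf) (auto simp: nn_integral_cmult)
  with m have "(\<integral>\<^sup>+ \<omega>. (\<Sum>n. w n * err m n \<omega>) \<partial>M) \<le> ennreal e" by simp
  then show ?thesis
    unfolding w_def err_def using mesh_bounds[of m] by (intro exI[of _ "mesh m"] exI[of _ "real m"]) simp
qed

lemma value_without_costs_upper:
  assumes int: "integrable M (X 1)" and q: "0 < q" and x: "0 \<le> x"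
  shows "value_without_costs M X q x < \<infinity>"
proof -
  obtain C where C: "0 \<le> C" "\<And>N::nat. (\<integral>\<^sup>+ \<omega>. running_sup (\<lambda>t. X t \<omega>) (real N) \<partial>M) \<le> ennreal (C * (1 + real N))"
    using expected_running_sup_linear[OF int] by blast
  let ?w = "\<lambda>n::nat. ennreal (q * exp (- q * real n))"
  \<comment> \<open>Here \<open>2 * C\<close> comes from \<open>n + 2 \<le> 2 * (n + 1)\<close>, as
    the supremum runs up to \<open>n + 1\<close>.\<close>
  let ?S = "\<Sum>n. ?w n * ennreal ((x + 2 * C) * (real n + 1))"
  have "enn2ereal (\<integral>\<^sup>+ \<omega>. discounted_dividends X q x L \<omega> \<partial>M) \<le> enn2ereal ?S"
    if L: "L \<in> admissible_strategies M X x" for L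
  proof -
    have "AE \<omega> in M. discounted_dividends X q x L \<omega> \<le> (\<Sum>n. ?w n * (ennreal x + running_sup (\<lambda>t. X t \<omega>) (real n + 1)))"
      using AE_upward_cadlag admissible_strategiesD(2)[OF L] AE_space
    proof eventually_elim
      case (elim \<omega>)
      note D = dividend_processD[OF admissible_strategiesD(1)[OF L] elim(3)]
      show ?case
        using elim(2) by (intro discounted_dividends_upper[where X=X and L=L and \<omega>=\<omega>, OF elim(1) D(1,2) _ _ q x]) (auto intro: D(3))
    qed
    then have "(\<integral>\<^sup>+ \<omega>. discounted_dividends X q x L \<omega> \<partial>M)
        \<le> (\<integral>\<^sup>+ \<omega>. (\<Sum>n. ?w n * (ennreal x + running_sup (\<lambda>t. X t \<omega>) (real n + 1))) \<partial>M)"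
      by (rule nn_integral_mono_AE)
    also have "\<dots> = (\<Sum>n. ?w n * (ennreal x + (\<integral>\<^sup>+ \<omega>. running_sup (\<lambda>t. X t \<omega>) (real n + 1) \<partial>M)))"
      by (subst nn_integral_suminf) (auto simp: nn_integral_cmult nn_integral_add emeasure_space_1)
    also have "\<dots> \<le> ?S"
    proof (intro suminf_le mult_left_mono)
      fix n :: nat
      have "ennreal x + (\<integral>\<^sup>+ \<omega>. running_sup (\<lambda>t. X t \<omega>) (real n + 1) \<partial>M) \<le> ennreal x + ennreal (C * (1 + real (n + 1)))"
        using C(2)[of "n + 1"] by (intro add_left_mono) (simp add: add.commute)
      also have "\<dots> = ennreal (x + C * (1 + real (n + 1)))" using x C(1) by simp
      also have "\<dots> \<le> ennreal ((x + 2 * C) * (real n + 1))"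
      proof (rule ennreal_leI)
        have "0 \<le> x * real n" "0 \<le> C * real n" using x C(1) by simp_all
        then show "x + C * (1 + real (n + 1)) \<le> (x + 2 * C) * (real n + 1)" by (simp add: algebra_simps)
      qed
      finally show "ennreal x + (\<integral>\<^sup>+ \<omega>. running_sup (\<lambda>t. X t \<omega>) (real n + 1) \<partial>M) \<le> ennreal ((x + 2 * C) * (real n + 1))" .
    qed auto
    finally show ?thesis by (simp add: less_eq_ennreal.rep_eq)
  qed
  then have "value_without_costs M X q x \<le> enn2ereal ?S"
    unfolding value_without_costs_def ereal_expectation_enn2ereal by (intro SUP_least)
  also have "enn2ereal ?S < \<infinity>"
  proof -
    have "?S < top" using x C(1) by (intro discounted_linear_series_finite[OF q]) simp
    then show ?thesis by (simp add: less_ennreal.rep_eq top_ennreal.rep_eq top_ereal_def)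
  qed
  finally show ?thesis .
qed

lemma value_without_costs_nonneg:
  assumes x: "0 \<le> x"
  shows "0 \<le> value_without_costs M X q x"
proof -
  have "dividend_process M X (\<lambda>_ _. 0)" by (auto simp: dividend_process_def mono_on_def)
  \<comment> \<open>A single admissible strategy suffices, since dividends are nonnegative; the grid
    version of the zero process is one.\<close>
  then have L: "lumped 1 0 x X (\<lambda>_ _. 0) \<in> admissible_strategies M X x"
    using x by (intro lumped_admissible) auto
  show ?thesis
    unfolding value_without_costs_def ereal_expectation_enn2ereal
    by (rule SUP_upper2[OF L]) simp
qed

lemma value_with_costs_le: "value_with_costs M X q \<beta> x \<le> value_without_costs M X q x"
  unfolding value_with_costs_def value_without_costs_def ereal_expectation_enn2ereal
  by (rule SUP_subset_mono, blast, rule ereal_expectation_diff_le)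

text \<open>The numbers \<open>d\<close> and \<open>a\<close> are chosen from \<open>e\<close>
  alone, before \<open>\<beta>\<close>, \<open>x\<close> and \<open>L\<close>, which makes the
  estimate uniform. The constant \<open>c\<close> is twice the geometric sum that bounds the
  discounted number of payments; the 2 stems from \<open>ereal_expectation_diff_ge\<close>.\<close>

lemma value_gap:
  assumes int: "integrable M (X 1)" and q: "0 < q" and e: "0 < e"
  shows "\<exists>c\<ge>0. \<forall>\<beta>>0. \<forall>x\<ge>0. value_without_costs M X q x \<le> value_with_costs M X q \<beta> x + ereal (e + \<beta> * c)"
proof -
  obtain d a where d: "0 < d" "d \<le> 1" and a: "0 \<le> a"
    and err: "(\<integral>\<^sup>+ \<omega>. (\<Sum>n. ennreal (q * exp (- q * real n)) * path_error q d a (\<lambda>t. X t \<omega>) n) \<partial>M) \<le> ennreal e"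
    using expected_path_error_small[OF int q e] by blast
  define k where "k = 1 / (1 - exp (- q * d))"
  have k: "0 \<le> k" using q d by (simp add: k_def)
  have "value_without_costs M X q x \<le> value_with_costs M X q \<beta> x + ereal (e + \<beta> * (2 * k))"
    if \<beta>: "0 < \<beta>" and x: "0 \<le> x" for \<beta> x
    unfolding value_without_costs_def ereal_expectation_enn2ereal
  proof (rule SUP_least)
    fix L assume L: "L \<in> admissible_strategies M X x"
    let ?L' = "lumped d a x X L"
    note DL = admissible_strategiesD(1)[OF L]
    have "AE \<omega> in M. discounted_dividends X q x L \<omega> \<le> discounted_dividends X q x ?L' \<omega> +
        (\<Sum>n. ennreal (q * exp (- q * real n)) * path_error q d a (\<lambda>t. X t \<omega>) n)"
      using AE_upward_cadlag admissible_strategiesD(2)[OF L] AE_space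
    proof eventually_elim
      case (elim \<omega>)
      note D = dividend_processD[OF DL elim(3)]
      show ?case
        using elim(2) by (intro discounted_dividends_le_lumped[where X=X and L=L and \<omega>=\<omega>, OF elim(1) D(1,2) _ _ q d a x]) (auto intro: D(3))
    qed
    then have "(\<integral>\<^sup>+ \<omega>. discounted_dividends X q x L \<omega> \<partial>M) \<le> (\<integral>\<^sup>+ \<omega>. discounted_dividends X q x ?L' \<omega> \<partial>M) +
        (\<integral>\<^sup>+ \<omega>. (\<Sum>n. ennreal (q * exp (- q * real n)) * path_error q d a (\<lambda>t. X t \<omega>) n) \<partial>M)"
      by (rule nn_integral_le_add_measurable[rotated]) measurable
    also have "\<dots> \<le> (\<integral>\<^sup>+ \<omega>. discounted_dividends X q x ?L' \<omega> \<partial>M) + ennreal e"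
      by (intro add_left_mono err)
    finally have "enn2ereal (\<integral>\<^sup>+ \<omega>. discounted_dividends X q x L \<omega> \<partial>M)
        \<le> enn2ereal (\<integral>\<^sup>+ \<omega>. discounted_dividends X q x ?L' \<omega> \<partial>M) + ereal e"
      using e by (simp add: less_eq_ennreal.rep_eq plus_ennreal.rep_eq enn2ereal_ennreal)
    also have "\<dots> \<le> (ereal_expectation M (\<lambda>\<omega>. enn2ereal (discounted_dividends X q x ?L' \<omega>)
          - enn2ereal (discounted_costs X q \<beta> x ?L' \<omega>)) + ereal (2 * (\<beta> * k))) + ereal e"
      using \<beta> k q d unfolding k_def by (intro add_right_mono ereal_expectation_diff_ge discounted_costs_lumped) auto
    also have "\<dots> \<le> (value_with_costs M X q \<beta> x + ereal (2 * (\<beta> * k))) + ereal e"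
      unfolding value_with_costs_def
      using lumped_admissible[OF DL d(1) x] pure_jump_lumped[OF d(1)] by (intro add_right_mono SUP_upper) auto
    also have "\<dots> = value_with_costs M X q \<beta> x + ereal (e + \<beta> * (2 * k))"
      by (cases "value_with_costs M X q \<beta> x") simp_all
    finally show "enn2ereal (\<integral>\<^sup>+ \<omega>. discounted_dividends X q x L \<omega> \<partial>M) \<le> value_with_costs M X q \<beta> x + ereal (e + \<beta> * (2 * k))" .
  qed
  then show ?thesis using k by (intro exI[of _ "2 * k"]) auto
qed

end

theorem proposition6p1:
  fixes M :: "'a measure" and X :: "real \<Rightarrow> 'a \<Rightarrow> real" and q :: real
  assumes "spectrally_positive_levy_process M X"
    and non_monotone:
      "\<not> (AE \<omega> in M. mono_on {0..} (\<lambda>t. X t \<omega>) \<or> antimono_on {0..} (\<lambda>t. X t \<omega>))"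
    and finite_mean: "integrable M (X 1)"
    and "0 < q"
  shows "(\<forall>x\<ge>0. \<bar>value_without_costs M X q x\<bar> \<noteq> \<infinity>) \<and>
    (\<forall>\<beta>>0. \<forall>x\<ge>0. \<bar>value_with_costs M X q \<beta> x\<bar> \<noteq> \<infinity>) \<and>
    uniform_limit {0..}
      (\<lambda>\<beta> x. real_of_ereal (value_with_costs M X q \<beta> x))
      (\<lambda>x. real_of_ereal (value_without_costs M X q x))
      (at_right 0)"
proof -
  interpret spectrally_positive_levy_process M X by fact
  let ?v = "value_without_costs M X q" and ?w = "value_with_costs M X q"
  have v: "\<exists>a. ?v x = ereal a" if "0 \<le> x" for x
    using value_without_costs_upper[OF finite_mean \<open>0 < q\<close> that] value_without_costs_nonneg[OF that, of q]
    by (cases "?v x") simp_all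
  have gap: "\<exists>c\<ge>0. \<forall>\<beta>>0. \<forall>x\<ge>0. ?v x \<le> ?w \<beta> x + ereal (e + \<beta> * c)" if "0 < e" for e
    by (rule value_gap[OF finite_mean \<open>0 < q\<close> that])
  \<comment> \<open>Finite from above by \<open>?v x\<close>, and from below by the gap estimate
    with an arbitrary fixed error, here 1.\<close>
  have w: "\<exists>b. ?w \<beta> x = ereal b" if "0 < \<beta>" "0 \<le> x" for \<beta> x
  proof -
    obtain a where a: "?v x = ereal a" using v[OF \<open>0 \<le> x\<close>] by (elim exE)
    obtain c where "?v x \<le> ?w \<beta> x + ereal (1 + \<beta> * c)" using gap[OF zero_less_one] \<open>0 < \<beta>\<close> \<open>0 \<le> x\<close> by blast
    moreover have "?w \<beta> x \<le> ?v x" by (rule value_with_costs_le)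
    ultimately show ?thesis unfolding a by (cases "?w \<beta> x") simp_all
  qed
  have "uniform_limit {0..} (\<lambda>\<beta> x. real_of_ereal (?w \<beta> x)) (\<lambda>x. real_of_ereal (?v x)) (at_right 0)"
  proof (rule uniform_limitI)
    fix e :: real assume e: "0 < e"
    obtain c where c: "0 \<le> c" "\<And>\<beta> x. 0 < \<beta> \<Longrightarrow> 0 \<le> x \<Longrightarrow> ?v x \<le> ?w \<beta> x + ereal (e / 2 + \<beta> * c)"
      using gap[OF half_gt_zero[OF e]] by meson
    \<comment> \<open>Half of \<open>e\<close> is spent on the change of strategy, less than the
      other half on the costs; \<open>c + 1\<close> keeps the denominator positive when
      \<open>c = 0\<close>.\<close>
    have "\<forall>x\<in>{0..}. dist (real_of_ereal (?w \<beta> x)) (real_of_ereal (?v x)) < e"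
      if \<beta>: "0 < \<beta>" "\<beta> < e / (2 * (c + 1))" for \<beta>
    proof
      fix x :: real assume "x \<in> {0..}"
      then have x: "0 \<le> x" by simp
      have "\<beta> * c \<le> \<beta> * (c + 1)" using \<beta>(1) by (intro mult_left_mono) auto
      also have "\<dots> < e / 2" using \<beta>(2) c(1) by (simp add: field_simps)
      finally have small: "\<beta> * c < e / 2" .
      obtain a b where ab: "?v x = ereal a" "?w \<beta> x = ereal b"
        using v[OF x] w[OF \<beta>(1) x] by (elim exE)
      have "b \<le> a" using value_with_costs_le[of q \<beta> x] unfolding ab by simp
      moreover have "a \<le> b + (e / 2 + \<beta> * c)" using c(2)[OF \<beta>(1) x] unfolding ab by simp
      ultimately show "dist (real_of_ereal (?w \<beta> x)) (real_of_ereal (?v x)) < e"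
        unfolding ab using small by (simp add: dist_real_def)
    qed
    moreover have "0 < e / (2 * (c + 1))" using e c(1) by simp
    ultimately show "eventually (\<lambda>\<beta>. \<forall>x\<in>{0..}. dist (real_of_ereal (?w \<beta> x)) (real_of_ereal (?v x)) < e) (at_right 0)"
      unfolding eventually_at_right_field by (intro exI[of _ "e / (2 * (c + 1))"]) simp
  qed
  moreover have "\<bar>?v x\<bar> \<noteq> \<infinity>" if "0 \<le> x" for x using v[OF that] by (elim exE) simp
  moreover have "\<bar>?w \<beta> x\<bar> \<noteq> \<infinity>" if "0 < \<beta>" "0 \<le> x" for \<beta> x using w[OF that] by (elim exE) simp
  ultimately show ?thesis by (intro conjI allI impI)
qed

end
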